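(* For $\alpha>0$ and a positive integer $k$, define $$A(k,\alpha,d)=-\frac{\sin\left(\frac{\alpha\pi}{2}\right)\Gamma(\alpha+1)\Gamma\left(\frac{\alpha+d}{2}\right)}{\pi^{\frac{d+1}{2}}\,S(k,\alpha)\,\Gamma\left(\frac{\alpha+1}{2}\right)},\qquad S(k,\alpha)=\sum_{m=1}^k\binom km(-1)^{k-m}m^\alpha .$$ Let $\mu\in\mathcal{P}_\alpha(\mathbb{R}^d)$ and let $\phi=\widehat\mu$ be its Fourier transform. (i) If $\alpha$ is not an integer and $0<\alpha<k$, then $$\int_{\mathbb{R}^d}|v|^\alpha\,d\mu(v)=A(k,\alpha,d)\int_{\mathbb{R}^d}\frac{\Delta_\xi^k(\phi)(0)}{|\xi|^{d+\alpha}}\,d\xi .$$ (ii) If $k$ is odd and either $\alpha$ is not an integer with $0<\alpha<k+1$, or $\alpha=k$, then $$\int_{\mathbb{R}^d}|v|^\alpha\,d\mu(v)=A(k,\alpha,d)\int_{\mathbb{R}^d}\frac{\Delta_\xi^k(\Re\,\phi)(0)}{|\xi|^{d+\alpha}}\,d\xi .$$ Moreover, in the case when $\alpha$ is not an integer with $0<\alpha<k$ (and $k$ is odd), both formulae coincide.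
   Context: Let $d\ge 1$ and let $|\cdot|$, $\cdot$ denote the Euclidean norm and inner product on $\mathbb{R}^d$. $\mathcal{P}(\mathbb{R}^d)$ is the set of Borel probability measures on $\mathbb{R}^d$ and, for $\alpha>0$, $\mathcal{P}_\alpha(\mathbb{R}^d)=\{\mu\in\mathcal{P}(\mathbb{R}^d):\int_{\mathbb{R}^d}|v|^\alpha d\mu(v)<\infty\}$. The Fourier transform of $\mu$ is $\widehat\mu(\xi)=\int_{\mathbb{R}^d}e^{-i\xi\cdot v}d\mu(v)$. For a scalar function $\phi$ on $\mathbb{R}^d$ and $\xi\in\mathbb{R}^d$, the $k$-th iterated forward difference evaluated at $0$ is $\Delta_\xi^k(\phi)(0)=\sum_{m=0}^k\binom km(-1)^{k-m}\phi(m\xi)$. $\Re\,\phi$ is the pointwise real part of $\phi$. $\Gamma$ is the gamma function. *)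

theory Defs
  imports "HOL-Probability.Probability"
begin

definition moment_prob_measures :: "real \<Rightarrow> 'a::euclidean_space measure set" where
  "moment_prob_measures \<alpha> =
     {\<mu>. prob_space \<mu> \<and> sets \<mu> = sets borel \<and> (\<integral>\<^sup>+ v. ennreal (norm v powr \<alpha>) \<partial>\<mu>) < \<infinity>}"

text \<open>Note the negative sign in the exponent; the library constant \<^const>\<open>char\<close> uses the positive sign
  and is restricted to the real line.\<close>

definition fourier_transform :: "'a::euclidean_space measure \<Rightarrow> 'a \<Rightarrow> complex" where
  "fourier_transform \<mu> \<xi> = (\<integral>v. exp (- (\<i> * complex_of_real (\<xi> \<bullet> v))) \<partial>\<mu>)"

text \<open>The binomial expansion of the \<open>k\<close>-fold forward difference of \<open>\<phi>\<close> with step \<open>\<xi>\<close>, evaluated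
  at the origin.\<close>

definition forward_diff0 :: "nat \<Rightarrow> ('a::real_vector \<Rightarrow> 'b::comm_ring_1) \<Rightarrow> 'a \<Rightarrow> 'b" where
  "forward_diff0 k \<phi> \<xi> =
     (\<Sum>m=0..k. of_nat (k choose m) * (- 1) ^ (k - m) * \<phi> (real m *\<^sub>R \<xi>))"

definition S_const :: "nat \<Rightarrow> real \<Rightarrow> real" where
  "S_const k \<alpha> = (\<Sum>m=1..k. real (k choose m) * (- 1) ^ (k - m) * real m powr \<alpha>)"

definition A_const :: "nat \<Rightarrow> real \<Rightarrow> nat \<Rightarrow> real" where
  "A_const k \<alpha> d =
     - (sin (\<alpha> * pi / 2) * Gamma (\<alpha> + 1) * Gamma ((\<alpha> + real d) / 2))
       / (pi powr ((real d + 1) / 2) * S_const k \<alpha> * Gamma ((\<alpha> + 1) / 2))"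

end

theory Submission imports Defs begin

text \<open>
  Write \<open>q = d + \<alpha>\<close> and \<open>h(s) = (exp (- \<i> s) - 1)^k\<close>.  By the binomial theorem the \<open>k\<close>-th difference of
  \<open>\<phi>\<close> at \<open>0\<close> with step \<open>\<xi>\<close> is the \<open>\<mu>\<close>-average of \<open>h(\<xi> \<bullet> v)\<close> over \<open>v\<close>, and that of \<open>Re \<phi>\<close> is the average
  of \<open>Re h(\<xi> \<bullet> v)\<close>.  So, by Fubini, both formulas follow from the case of a point mass: the integral of
  \<open>h(\<xi> \<bullet> v) / \<bar>\<xi>\<bar>^q\<close> (or of its real part) over \<open>\<xi>\<close> is a constant times \<open>\<bar>v\<bar>^\<alpha>\<close>, and the constant is
  \<open>1 / A(k,\<alpha>,d)\<close>.

  Homogeneity and rotation invariance explain the power of \<open>\<bar>v\<bar>\<close>, but the constant is needed as well.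
  Both come out together if the kernel is written as a mixture of Gaussians
  (\<open>has_bochner_integral_inverse_Gamma\<close>):
  \<open>\<Gamma>(q/2) \<bar>\<xi>\<bar>^(-q) = \<integral> u^(-q/2-1) exp(-\<bar>\<xi>\<bar>\<^sup>2/u) du\<close> over \<open>u > 0\<close>.
  The Gaussian integral over \<open>\<xi>\<close> is explicit and turns each \<open>exp(- \<i> m \<xi> \<bullet> v)\<close> into
  \<open>(\<pi>u)^(d/2) exp(-u m\<^sup>2\<bar>v\<bar>\<^sup>2/4)\<close>.  What remains is the Mellin transform at \<open>-\<alpha>/2\<close> of the exponential sum
  with signed binomial coefficients \<open>c_m\<close> and exponents \<open>l_m = m\<^sup>2\<bar>v\<bar>\<^sup>2/4\<close>.  Taken termwise it would be
  \<open>\<Gamma>(-\<alpha>/2) c_m l_m^(\<alpha>/2)\<close>, and although the termwise integrals diverge, this value is correct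
  (\<open>mellin_exponential_sum\<close>) because the sums of \<open>c_m m^(2j)\<close> vanish for \<open>2j < k\<close>, so that the
  exponential sum has a zero of order above \<open>\<alpha>/2\<close> at \<open>u = 0\<close>.  The sum of the \<open>c_m l_m^(\<alpha>/2)\<close> is \<open>S(k,\<alpha>)\<close>
  up to elementary factors, and the duplication and reflection formulas of \<open>\<Gamma>\<close> identify the resulting
  constant as \<open>1 / A(k,\<alpha>,d)\<close>; that \<open>S(k,\<alpha>) \<noteq> 0\<close> follows from the mean value theorem for iterated differences.

  Absolute convergence rests on \<open>h\<close> being bounded and of size \<open>\<bar>s\<bar>^p\<close> at \<open>0\<close> with \<open>\<alpha> < p\<close>.  For \<open>h\<close> itself
  \<open>p = k\<close>; for odd \<open>k\<close> the real part gains one order, \<open>p = k + 1\<close>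
  (\<open>Re_diff_exp_small\<close>), which is what admits the larger range of \<open>\<alpha>\<close> in the second formula.
  Since the Gaussian integral of \<open>h(\<xi> \<bullet> v)\<close> is real, \<open>h\<close> and \<open>Re h\<close> yield the same constant, and where
  both formulas apply their integrals agree.
\<close>

section \<open>Gamma integrals and power integrals\<close>

lemma has_bochner_integral_of_has_integral_nonneg:
  fixes f :: "real \<Rightarrow> real"
  assumes "(f has_integral I) S" "\<And>t. 0 \<le> f t" "f \<in> borel_measurable borel" "S \<in> sets borel"
  shows "has_bochner_integral lborel (\<lambda>t. indicator S t * f t) I"
proof (rule has_bochner_integral_nn_integral)
  show "0 \<le> I" using assms by (intro has_integral_nonneg[OF assms(1)]) auto
  have "(\<lambda>x. indicator S x * f x) = (\<lambda>x. if x \<in> S then f x else 0)" by auto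
  then have "((\<lambda>x. indicator S x * f x) has_integral I) UNIV"
    using assms(1) by (simp only: has_integral_restrict_UNIV)
  then show "(\<integral>\<^sup>+ x. ennreal (indicator S x * f x) \<partial>lborel) = ennreal I"
    using assms by (intro nn_integral_has_integral_lborel) auto
qed (use assms in auto)

lemma Gamma_has_integral_open:
  assumes "a > (0::real)"
  shows "((\<lambda>t. t powr (a - 1) * exp (- t)) has_integral Gamma a) {0<..}"
proof -
  have "((\<lambda>t. t powr (a - 1) / exp t) has_integral Gamma a) {0<..}"
  proof (subst has_integral_spike_set_eq)
    show "negligible {x \<in> {0<..} - {0..}. x powr (a - 1) / exp x \<noteq> 0}"
      by (rule negligible_subset[of "{}"]) auto
    show "negligible {x \<in> {0..} - {0<..}. x powr (a - 1) / exp x \<noteq> 0}"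
      by (rule negligible_subset[of "{0}"]) auto
    show "((\<lambda>t. t powr (a - 1) / exp t) has_integral Gamma a) {0..}"
      by (rule Gamma_integral_real[OF assms])
  qed
  then show ?thesis by (simp add: exp_minus divide_inverse)
qed

text \<open>Absolute integrability of the Gamma integrand makes the one-dimensional change of variables
  available for any differentiable bijection of the half-line; the two kernels below are the cases
  \<open>g u = l u\<close> and \<open>g u = r / u\<close>.\<close>

lemma has_bochner_integral_Gamma_change_of_variables:
  fixes g g' :: "real \<Rightarrow> real"
  assumes "a > 0" and "bij_betw g {0<..} {0<..}"
    and d: "\<And>u. u > 0 \<Longrightarrow> (g has_field_derivative g' u) (at u)"
    and b: "(\<lambda>u. \<bar>g' u\<bar> * (g u powr (a - 1) * exp (- g u))) \<in> borel_measurable borel"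
  shows "has_bochner_integral lborel
           (\<lambda>u. indicator {0<..} u * (\<bar>g' u\<bar> * (g u powr (a - 1) * exp (- g u)))) (Gamma a)"
proof -
  have "(\<lambda>t. t powr (a - 1) * exp (- t)) absolutely_integrable_on {0<..}"
    using Gamma_has_integral_open[OF assms(1)]
    by (intro nonnegative_absolutely_integrable_1) (auto simp: has_integral_integrable)
  moreover have "integral {0<..} (\<lambda>t. t powr (a - 1) * exp (- t)) = Gamma a"
    using Gamma_has_integral_open[OF assms(1)] by (rule integral_unique)
  ultimately have
    "(\<lambda>u. \<bar>g' u\<bar> * (g u powr (a - 1) * exp (- g u))) absolutely_integrable_on {0<..} \<and>
     integral {0<..} (\<lambda>u. \<bar>g' u\<bar> * (g u powr (a - 1) * exp (- g u))) = Gamma a"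
    using assms(2)
    by (subst has_absolute_integral_change_of_variables_1')
       (auto simp: bij_betw_def intro: DERIV_subset[OF d])
  then have "((\<lambda>u. \<bar>g' u\<bar> * (g u powr (a - 1) * exp (- g u))) has_integral Gamma a) {0<..}"
    by (auto simp: has_integral_iff absolutely_integrable_on_def)
  then show ?thesis by (rule has_bochner_integral_of_has_integral_nonneg) (use b in auto)
qed

lemma has_bochner_integral_Gamma_scaled:
  assumes "a > (0::real)" "l > 0"
  shows "has_bochner_integral lborel (\<lambda>u. indicator {0<..} u * (u powr (a - 1) * exp (- (l * u))))
           (Gamma a * l powr - a)"
proof -
  have "has_bochner_integral lborel
          (\<lambda>u. indicator {0<..} u * (\<bar>l\<bar> * ((l * u) powr (a - 1) * exp (- (l * u))))) (Gamma a)"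
    by (rule has_bochner_integral_Gamma_change_of_variables[OF assms(1)])
       (use assms in \<open>auto intro!: bij_betwI[where g="\<lambda>x. x / l"] derivative_eq_intros simp: field_simps\<close>)
  from has_bochner_integral_mult_right[OF this, of "l powr - a"]
  have "has_bochner_integral lborel
     (\<lambda>u. l powr - a * (indicator {0<..} u * (\<bar>l\<bar> * ((l * u) powr (a - 1) * exp (- (l * u))))))
     (Gamma a * l powr - a)" by (simp add: mult.commute)
  also have "(\<lambda>u. l powr - a * (indicator {0<..} u * (\<bar>l\<bar> * ((l * u) powr (a - 1) * exp (- (l * u)))))) =
     (\<lambda>u. indicator {0<..} u * (u powr (a - 1) * exp (- (l * u))))"
  proof
    fix u
    have "l powr - a * (l * l powr (a - 1)) = 1"
      using assms by (simp add: powr_diff powr_minus field_simps)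
    then show "l powr - a * (indicator {0<..} u * (\<bar>l\<bar> * ((l * u) powr (a - 1) * exp (- (l * u))))) =
      indicator {0<..} u * (u powr (a - 1) * exp (- (l * u)))"
      using assms by (cases "u > 0") (auto simp: powr_mult mult_ac)
  qed
  finally show ?thesis .
qed

text \<open>With \<open>r = \<bar>\<xi>\<bar>\<^sup>2\<close> this exhibits a negative power of \<open>\<bar>\<xi>\<bar>\<close> as a mixture of Gaussians. The parameter
  is the variance rather than its inverse, so that the Gaussian Fourier transform will produce
  \<open>exp (- u * l)\<close> and hence a Mellin integral in \<open>u\<close>.\<close>

lemma has_bochner_integral_inverse_Gamma:
  assumes "a > (0::real)" "r > 0"
  shows "has_bochner_integral lborel (\<lambda>u. indicator {0<..} u * (u powr (- a - 1) * exp (- (r / u))))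
           (Gamma a * r powr - a)"
proof -
  have bij: "bij_betw (\<lambda>u. r / u) {0<..} {0<..}"
    using assms by (intro bij_betwI[where g="\<lambda>u. r / u"]) auto
  have "has_bochner_integral lborel
          (\<lambda>u. indicator {0<..} u * (\<bar>- (r / u\<^sup>2)\<bar> * ((r / u) powr (a - 1) * exp (- (r / u))))) (Gamma a)"
    by (rule has_bochner_integral_Gamma_change_of_variables[OF assms(1) bij])
       (use assms in \<open>auto intro!: derivative_eq_intros simp: power2_eq_square\<close>)
  from has_bochner_integral_mult_right[OF this, of "r powr - a"]
  have "has_bochner_integral lborel
     (\<lambda>u. r powr - a * (indicator {0<..} u * (\<bar>- (r / u\<^sup>2)\<bar> * ((r / u) powr (a - 1) * exp (- (r / u))))))
     (Gamma a * r powr - a)" by (simp add: mult.commute)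
  also have "(\<lambda>u. r powr - a * (indicator {0<..} u * (\<bar>- (r / u\<^sup>2)\<bar> * ((r / u) powr (a - 1) * exp (- (r / u)))))) =
     (\<lambda>u. indicator {0<..} u * (u powr (- a - 1) * exp (- (r / u))))"
  proof
    fix u
    show "r powr - a * (indicator {0<..} u * (\<bar>- (r / u\<^sup>2)\<bar> * ((r / u) powr (a - 1) * exp (- (r / u))))) =
      indicator {0<..} u * (u powr (- a - 1) * exp (- (r / u)))"
    proof (cases "u > 0")
      case True
      have "r powr - a * (r / u\<^sup>2 * (r / u) powr (a - 1)) = u powr (- a - 1)"
        using assms True
        by (simp add: powr_divide powr_diff powr_minus field_simps power2_eq_square)
      then have "r powr - a * (r / u\<^sup>2 * (r / u) powr (a - 1)) * exp (- (r / u)) = u powr (- a - 1) * exp (- (r / u))"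
        by (rule arg_cong)
      moreover have "\<bar>- (r / u\<^sup>2)\<bar> = r / u\<^sup>2" using assms by simp
      ultimately show ?thesis using True by (simp only: mult.assoc indicator_def greaterThan_iff) simp
    qed simp
  qed
  finally show ?thesis .
qed

lemma has_bochner_integral_powr_at_0:
  fixes b c :: real
  assumes "b > 0" "c \<ge> 0"
  shows "has_bochner_integral lborel (\<lambda>u. indicator {0..c} u * u powr (b - 1)) (c powr b / b)"
  using has_bochner_integral_of_has_integral_nonneg[OF has_integral_powr_from_0[of "b - 1" c]] assms
  by simp

lemma has_bochner_integral_powr_at_infinity:
  fixes a c :: real
  assumes "a > 0" "c > 0"
  shows "has_bochner_integral lborel (\<lambda>u. indicator {c..} u * u powr (- a - 1)) (c powr - a / a)"
  using has_bochner_integral_of_has_integral_nonneg[OF has_integral_powr_to_inf[of "- a - 1" c]] assms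
  by simp

section \<open>Mellin transforms of exponential sums\<close>

text \<open>If the power moments of the coefficients vanish below order \<open>J\<close>, then so do the Taylor coefficients at
  \<open>0\<close>. Instead of Taylor's formula: the derivative is again an exponential sum, with coefficients
  \<open>c i * l i\<close> whose moments vanish below \<open>J - 1\<close>, and the mean value theorem gains one power of \<open>u\<close>.\<close>

lemma exponential_sum_bound:
  fixes c l :: "'i \<Rightarrow> real"
  assumes "finite I" "\<And>i. i \<in> I \<Longrightarrow> l i \<ge> 0"
    and "\<And>j. j < J \<Longrightarrow> (\<Sum>i\<in>I. c i * l i ^ j) = 0"
  shows "\<exists>C\<ge>0. \<forall>u\<ge>0. \<bar>\<Sum>i\<in>I. c i * exp (- (u * l i))\<bar> \<le> C * u ^ J"
  using assms(3)
proof (induction J arbitrary: c)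
  case 0
  have "\<bar>\<Sum>i\<in>I. c i * exp (- (u * l i))\<bar> \<le> (\<Sum>i\<in>I. \<bar>c i\<bar>)" if "u \<ge> 0" for u
  proof -
    have "\<bar>\<Sum>i\<in>I. c i * exp (- (u * l i))\<bar> \<le> (\<Sum>i\<in>I. \<bar>c i * exp (- (u * l i))\<bar>)"
      by (rule sum_abs)
    also have "\<dots> \<le> (\<Sum>i\<in>I. \<bar>c i\<bar>)"
      using assms(2) that by (intro sum_mono) (auto simp: abs_mult intro!: mult_left_le)
    finally show ?thesis .
  qed
  then show ?case by (intro exI[of _ "\<Sum>i\<in>I. \<bar>c i\<bar>"]) (auto intro: sum_nonneg)
next
  case (Suc J)
  have "(\<Sum>i\<in>I. (c i * l i) * l i ^ j) = 0" if "j < J" for j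
    using Suc.prems[of "Suc j"] that by (simp add: mult_ac)
  from Suc.IH[OF this] obtain C where C: "C \<ge> 0"
    "\<And>u. u \<ge> 0 \<Longrightarrow> \<bar>\<Sum>i\<in>I. c i * l i * exp (- (u * l i))\<bar> \<le> C * u ^ J" by blast
  define g where "g u = (\<Sum>i\<in>I. c i * exp (- (u * l i)))" for u
  have d: "(g has_field_derivative - (\<Sum>i\<in>I. c i * l i * exp (- (u * l i)))) (at u)" for u
    unfolding g_def by (auto intro!: derivative_eq_intros sum.cong simp: sum_negf[symmetric])
  have g0: "g 0 = 0" using Suc.prems[of 0] by (simp add: g_def)
  have "\<bar>g u\<bar> \<le> C * u ^ Suc J" if u: "u \<ge> 0" for u
  proof (cases "u = 0")
    case False
    then obtain z where z: "0 < z" "z < u" "g u - g 0 = (u - 0) * - (\<Sum>i\<in>I. c i * l i * exp (- (z * l i)))"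
      using MVT2[of 0 u g, OF _ d] u by auto
    have "\<bar>g u\<bar> = u * \<bar>\<Sum>i\<in>I. c i * l i * exp (- (z * l i))\<bar>"
      using z u g0 by (simp add: abs_mult)
    also have "\<dots> \<le> u * (C * z ^ J)" using C z u by (intro mult_left_mono) auto
    also have "\<dots> \<le> u * (C * u ^ J)" using C z u by (intro mult_left_mono power_mono) auto
    finally show ?thesis by (simp add: mult_ac)
  qed (simp add: g0)
  then show ?case using C(1) unfolding g_def by blast
qed

lemma exponential_sum_integrable:
  fixes c l :: "'i \<Rightarrow> real"
  assumes "finite I" "\<And>i. i \<in> I \<Longrightarrow> l i \<ge> 0" "0 < s" "s < real J"
    and "\<And>j. j < J \<Longrightarrow> (\<Sum>i\<in>I. c i * l i ^ j) = 0"
  shows "integrable lborel (\<lambda>u. indicator {0<..} u * (u powr (- s - 1) * (\<Sum>i\<in>I. c i * exp (- (u * l i)))))"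
proof -
  obtain C where C: "C \<ge> 0" "\<And>u. u \<ge> 0 \<Longrightarrow> \<bar>\<Sum>i\<in>I. c i * exp (- (u * l i))\<bar> \<le> C * u ^ J"
    using exponential_sum_bound[OF assms(1,2,5)] by blast
  obtain D where D: "D \<ge> 0" "\<And>u. u \<ge> 0 \<Longrightarrow> \<bar>\<Sum>i\<in>I. c i * exp (- (u * l i))\<bar> \<le> D"
    using exponential_sum_bound[of I l 0 c] assms(1,2) by auto
  have "integrable lborel (\<lambda>u::real. C * (indicator {0..1} u * u powr (real J - s - 1)) +
       D * (indicator {1..} u * u powr (- s - 1)))"
    using has_bochner_integral_powr_at_0[of "real J - s" 1] has_bochner_integral_powr_at_infinity[of s 1] assms
    by (intro Bochner_Integration.integrable_add integrable_mult_right) (auto simp: has_bochner_integral_iff)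
  then show ?thesis
  proof (rule Bochner_Integration.integrable_bound)
    show "AE u in lborel. norm (indicator {0<..} u * (u powr (- s - 1) * (\<Sum>i\<in>I. c i * exp (- (u * l i)))))
      \<le> norm (C * (indicator {0..1} u * u powr (real J - s - 1)) + D * (indicator {1..} u * u powr (- s - 1)))"
    proof (intro AE_I2)
      fix u :: real
      let ?g = "\<Sum>i\<in>I. c i * exp (- (u * l i))"
      show "norm (indicator {0<..} u * (u powr (- s - 1) * ?g))
        \<le> norm (C * (indicator {0..1} u * u powr (real J - s - 1)) + D * (indicator {1..} u * u powr (- s - 1)))"
      proof (cases "u > 0")
        case u: True
        show ?thesis
        proof (cases "u \<le> 1")
          case True
          have "norm (u powr (- s - 1) * ?g) = u powr (- s - 1) * \<bar>?g\<bar>" by (simp add: abs_mult)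
          also have "\<dots> \<le> u powr (- s - 1) * (C * u ^ J)" using C(2)[of u] u by (intro mult_left_mono) auto
          also have "\<dots> = C * (u powr (- s - 1) * u powr real J)" using u by (simp add: powr_realpow)
          also have "\<dots> = C * u powr (real J - s - 1)" by (simp add: powr_add[symmetric] algebra_simps)
          also have "\<dots> \<le> C * (indicator {0..1} u * u powr (real J - s - 1)) + D * (indicator {1..} u * u powr (- s - 1))"
            using u True D by simp
          finally show ?thesis using u by simp
        next
          case False
          have "norm (u powr (- s - 1) * ?g) = u powr (- s - 1) * \<bar>?g\<bar>" by (simp add: abs_mult)
          also have "\<dots> \<le> u powr (- s - 1) * D" using D(2)[of u] u by (intro mult_left_mono) auto
          finally show ?thesis using u False D by (simp add: mult.commute)
        qed
      qed simp
    qed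
  qed simp
qed

text \<open>For negative \<open>s\<close> this is the Gamma integral, term by term. For positive \<open>s\<close> only the whole sum is
  integrable at \<open>0\<close>; integration by parts replaces \<open>s\<close> by \<open>s - 1\<close>, the coefficients \<open>c i\<close> by \<open>c i * l i\<close>
  and \<open>J\<close> by \<open>J - 1\<close>, until the exponent is negative, and the functional equation of \<open>\<Gamma>\<close> absorbs the
  factor produced by each step. The last hypothesis excludes constant terms, which have no integral when
  \<open>s < 0\<close>; after an integration by parts it holds automatically.\<close>

lemma mellin_exponential_sum:
  fixes c l :: "'i \<Rightarrow> real" and s :: real
  assumes "finite I" "\<And>i. i \<in> I \<Longrightarrow> l i \<ge> 0"
    and "s < real J" "\<And>n. s \<noteq> real n"
    and "\<And>j. j < J \<Longrightarrow> (\<Sum>i\<in>I. c i * l i ^ j) = 0"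
    and "\<And>i. s < 0 \<Longrightarrow> i \<in> I \<Longrightarrow> l i = 0 \<Longrightarrow> c i = 0"
  shows "has_bochner_integral lborel
           (\<lambda>u. indicator {0<..} u * (u powr (- s - 1) * (\<Sum>i\<in>I. c i * exp (- (u * l i)))))
           (Gamma (- s) * (\<Sum>i\<in>I. c i * l i powr s))"
  using assms(3-)
proof (induction J arbitrary: c s)
  have neg: "has_bochner_integral lborel
           (\<lambda>u. indicator {0<..} u * (u powr (- s - 1) * (\<Sum>i\<in>I. c i * exp (- (u * l i)))))
           (Gamma (- s) * (\<Sum>i\<in>I. c i * l i powr s))"
    if s: "s < 0" and z: "\<And>i. i \<in> I \<Longrightarrow> l i = 0 \<Longrightarrow> c i = 0" for c s
  proof -
    have "has_bochner_integral lborel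
       (\<lambda>u. \<Sum>i\<in>I. c i * (indicator {0<..} u * (u powr (- s - 1) * exp (- (l i * u)))))
       (\<Sum>i\<in>I. c i * (Gamma (- s) * l i powr s))"
    proof (rule has_bochner_integral_sum)
      fix i assume i: "i \<in> I"
      show "has_bochner_integral lborel (\<lambda>u. c i * (indicator {0<..} u * (u powr (- s - 1) * exp (- (l i * u)))))
         (c i * (Gamma (- s) * l i powr s))"
      proof (cases "l i = 0")
        case True
        then show ?thesis using z[OF i] by (simp add: has_bochner_integral_zero)
      next
        case False
        then show ?thesis
          using has_bochner_integral_mult_right[OF has_bochner_integral_Gamma_scaled[of "- s" "l i"], of "c i"] s assms(2)[OF i]
          by simp
      qed
    qed
    then show ?thesis by (simp add: sum_distrib_left mult_ac)
  qed
  {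
    case 0
    then show ?case by (intro neg) auto
  next
    case (Suc J)
    show ?case
    proof (cases "s < 0")
      case True
      then show ?thesis by (intro neg Suc.prems(4))
    next
      case False
      then have s: "s > 0" using Suc.prems(2)[of 0] by auto
      define g where "g u = (\<Sum>i\<in>I. c i * exp (- (u * l i)))" for u
      define h where "h u = (\<Sum>i\<in>I. (c i * l i) * exp (- (u * l i)))" for u
      have dg: "(g has_field_derivative - h u) (at u)" for u
        unfolding g_def h_def by (auto intro!: derivative_eq_intros sum.cong simp: sum_negf[symmetric])
      have ch: "isCont h u" for u unfolding h_def by (intro continuous_intros)
      have ih: "has_bochner_integral lborel
           (\<lambda>u. indicator {0<..} u * (u powr (- (s - 1) - 1) * (\<Sum>i\<in>I. (c i * l i) * exp (- (u * l i)))))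
           (Gamma (- (s - 1)) * (\<Sum>i\<in>I. (c i * l i) * l i powr (s - 1)))"
      proof (rule Suc.IH)
        show "s - 1 < real J" using Suc.prems by simp
        show "s - 1 \<noteq> real n" for n using Suc.prems(2)[of "Suc n"] by auto
        show "(\<Sum>i\<in>I. (c i * l i) * l i ^ j) = 0" if "j < J" for j
          using Suc.prems(3)[of "Suc j"] that by (simp add: mult_ac)
      qed simp
      have gi: "integrable lborel (\<lambda>u. indicator {0<..} u * (u powr (- s - 1) * g u))"
        unfolding g_def by (rule exponential_sum_integrable[of _ _ _ "Suc J"]) (use assms(1,2) s Suc.prems in auto)
      have hi: "integrable lborel (\<lambda>u. indicator {0<..} u * (u powr (- s) * h u))"
        and hv: "(\<integral>u. indicator {0<..} u * (u powr (- s) * h u) \<partial>lborel) =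
           Gamma (- s + 1) * (\<Sum>i\<in>I. c i * l i powr s)"
      proof -
        have "(c i * l i) * l i powr (s - 1) = c i * l i powr s" if "i \<in> I" for i
          using assms(2)[OF that] by (cases "l i = 0") (auto simp: powr_diff)
        then have "(\<Sum>i\<in>I. (c i * l i) * l i powr (s - 1)) = (\<Sum>i\<in>I. c i * l i powr s)" by (rule sum.cong[OF refl])
        with ih show "integrable lborel (\<lambda>u. indicator {0<..} u * (u powr (- s) * h u))"
          "(\<integral>u. indicator {0<..} u * (u powr (- s) * h u) \<partial>lborel) =
           Gamma (- s + 1) * (\<Sum>i\<in>I. c i * l i powr s)"
          by (simp_all add: h_def has_bochner_integral_iff)
      qed
      \<comment> \<open>The boundary term of the integration by parts; it vanishes at \<open>0\<close> because \<open>g u = O(u ^ Suc J)\<close>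
        with \<open>Suc J > s\<close>, and at infinity because \<open>g\<close> is bounded.\<close>
      define F where "F u = - (u powr (- s) * g u)" for u
      define f where "f u = s * (u powr (- s - 1) * g u) + u powr (- s) * h u" for u
      have fi: "set_integrable lborel {0<..} f"
        unfolding set_integrable_def f_def real_scaleR_def distrib_left
        using integrable_mult_right[OF gi, of s] hi
        by (intro Bochner_Integration.integrable_add) (simp_all add: mult_ac)
      obtain C where C: "C \<ge> 0" "\<And>u. u \<ge> 0 \<Longrightarrow> \<bar>g u\<bar> \<le> C * u ^ Suc J"
        using exponential_sum_bound[OF assms(1,2) Suc.prems(3)] unfolding g_def by blast
      obtain D where D: "D \<ge> 0" "\<And>u. u \<ge> 0 \<Longrightarrow> \<bar>g u\<bar> \<le> D"
        using exponential_sum_bound[of I l 0 c] assms(1,2) unfolding g_def by auto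
      have F0: "(F \<longlongrightarrow> 0) (at_right 0)"
      proof (rule Lim_null_comparison)
        show "\<forall>\<^sub>F u in at_right 0. norm (F u) \<le> C * u powr (real (Suc J) - s)"
          unfolding eventually_at_right_field
        proof (intro exI[of _ 1] conjI allI impI)
          fix u :: real assume u: "0 < u" "u < 1"
          have "norm (F u) \<le> u powr (- s) * (C * u ^ Suc J)"
            unfolding F_def using C(2)[of u] u by (simp add: abs_mult)
          also have "\<dots> = C * (u powr (- s) * u powr real (Suc J))"
            using u by (subst powr_realpow) auto
          also have "\<dots> = C * u powr (real (Suc J) - s)" by (simp add: powr_add[symmetric])
          finally show "norm (F u) \<le> C * u powr (real (Suc J) - s)" .
        qed simp
        have "((\<lambda>u. C * u powr (real (Suc J) - s)) \<longlongrightarrow> C * (0 powr (real (Suc J) - s))) (at_right 0)"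
          by (intro tendsto_intros tendsto_powr2)
             (use Suc.prems(1) in \<open>auto intro: eventually_at_right_less simp: eventually_at_filter\<close>)
        then show "((\<lambda>u. C * u powr (real (Suc J) - s)) \<longlongrightarrow> 0) (at_right 0)" by simp
      qed
      have Finf: "(F \<longlongrightarrow> 0) at_top"
      proof (rule Lim_null_comparison)
        show "\<forall>\<^sub>F u in at_top. norm (F u) \<le> D * u powr (- s)"
          using eventually_ge_at_top[of 0]
        proof eventually_elim
          case (elim u)
          then show ?case unfolding F_def using mult_left_mono[OF D(2)[OF elim], of "u powr (- s)"]
            by (simp add: abs_mult mult.commute)
        qed
        have "((\<lambda>u. u powr (- s)) \<longlongrightarrow> 0) at_top"
          by (rule tendsto_neg_powr) (use s in \<open>auto intro: filterlim_ident\<close>)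
        from tendsto_mult_right[OF this, of D] show "((\<lambda>u. D * u powr (- s)) \<longlongrightarrow> 0) at_top"
          by (simp add: mult.commute)
      qed
      have "(LBINT u=0..\<infinity>. f u) = 0 - 0"
      proof (rule interval_integral_FTC_integrable)
        fix u :: real assume "0 < ereal u" "ereal u < \<infinity>"
        then have u: "u > 0" by simp
        have p: "u powr (- s - 1) = u powr (- s) / u" using u by (simp add: powr_diff)
        show "(F has_vector_derivative f u) (at u)"
          unfolding F_def f_def has_real_derivative_iff_has_vector_derivative[symmetric]
          using u by (auto intro!: derivative_eq_intros dg simp: p)
        show "isCont f u"
          unfolding f_def using u by (intro continuous_intros ch DERIV_isCont[OF dg]) auto
      next
        show "set_integrable lborel (einterval 0 \<infinity>) f"
          using fi by (simp add: einterval_def zero_ereal_def greaterThan_def)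
        show "((F \<circ> real_of_ereal) \<longlongrightarrow> 0) (at_right 0)"
          unfolding zero_ereal_def ereal_tendsto_simps by (rule F0)
        show "((F \<circ> real_of_ereal) \<longlongrightarrow> 0) (at_left \<infinity>)"
          unfolding ereal_tendsto_simps by (rule Finf)
      qed simp
      then have "0 = (\<integral>u. indicator {0<..} u * f u \<partial>lborel)"
        by (simp add: interval_lebesgue_integral_0_infty set_lebesgue_integral_def)
      also have "\<dots> = (\<integral>u. s * (indicator {0<..} u * (u powr (- s - 1) * g u)) +
           indicator {0<..} u * (u powr (- s) * h u) \<partial>lborel)"
        by (intro Bochner_Integration.integral_cong) (auto simp: f_def algebra_simps)
      also have "\<dots> = s * (\<integral>u. indicator {0<..} u * (u powr (- s - 1) * g u) \<partial>lborel) +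
          Gamma (- s + 1) * (\<Sum>i\<in>I. c i * l i powr s)"
        using gi hi hv by (subst Bochner_Integration.integral_add) auto
      also have "Gamma (- s + 1) = - s * Gamma (- s)"
      proof (rule Gamma_plus1)
        show "- s \<notin> \<int>\<^sub>\<le>\<^sub>0" using Suc.prems(2) by (auto elim!: nonpos_Ints_cases')
      qed
      finally have "s * (\<integral>u. indicator {0<..} u * (u powr (- s - 1) * g u) \<partial>lborel) =
         s * (Gamma (- s) * (\<Sum>i\<in>I. c i * l i powr s))" by simp
      then show ?thesis using gi s by (simp add: has_bochner_integral_iff g_def)
    qed
  }
qed

section \<open>Fourier transform of the Gaussian\<close>

text \<open>The substitution \<open>x = sqrt (u / 2) * y\<close> reduces this to the characteristic function of the standard normal
  distribution.\<close>

lemma gaussian_fourier_real: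
  fixes a u :: real
  assumes "u > 0"
  shows "integrable lborel (\<lambda>x. exp (- (\<i> * complex_of_real (x * a))) * exp (- complex_of_real (x\<^sup>2 / u)))"
    and "(\<integral>x. exp (- (\<i> * complex_of_real (x * a))) * exp (- complex_of_real (x\<^sup>2 / u)) \<partial>lborel) =
           complex_of_real (sqrt (pi * u) * exp (- (u * a\<^sup>2 / 4)))"
proof -
  \<comment> \<open>\<open>s\<close> rescales the Gaussian to unit variance.\<close>
  define s where "s = sqrt (u / 2)"
  have s: "s > 0" "s\<^sup>2 = u / 2" using assms by (auto simp: s_def)
  define F where "F x = exp (- (\<i> * complex_of_real (x * a))) * exp (- complex_of_real (x\<^sup>2 / u))" for x
  have Fs: "F (0 + s * y) = complex_of_real (sqrt (2 * pi)) *
      (std_normal_density y *\<^sub>R iexp ((- (s * a)) * y))" for y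
  proof -
    have "(s * y)\<^sup>2 / u = y\<^sup>2 / 2" using s assms by (simp add: power_mult_distrib field_simps)
    then have "exp (- complex_of_real ((s * y)\<^sup>2 / u)) = complex_of_real (exp (- y\<^sup>2 / 2))"
      by (simp only: exp_of_real[symmetric]) simp
    also have "exp (- y\<^sup>2 / 2) = sqrt (2 * pi) * std_normal_density y"
      by (simp add: std_normal_density_def)
    finally have 1: "exp (- complex_of_real ((s * y)\<^sup>2 / u)) =
        complex_of_real (sqrt (2 * pi)) * complex_of_real (std_normal_density y)"
      by (simp only: of_real_mult)
    have 2: "- (\<i> * complex_of_real ((s * y) * a)) = \<i> * complex_of_real ((- (s * a)) * y)"
      by (simp add: mult_ac)
    show ?thesis
      unfolding F_def add_0 1 2 scaleR_conv_of_real by (simp only: mult_ac)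
  qed
  have cont: "integrable std_normal_distribution (\<lambda>x. iexp ((- (s * a)) * x))"
  proof -
    interpret real_distribution std_normal_distribution by (rule real_dist_normal_dist)
    show ?thesis by (rule integrable_iexp) auto
  qed
  then have i: "integrable lborel (\<lambda>y. std_normal_density y *\<^sub>R iexp ((- (s * a)) * y))"
    by (subst (asm) integrable_density) auto
  then have "integrable lborel (\<lambda>y. F (0 + s * y))" unfolding Fs by (rule integrable_mult_right)
  then show "integrable lborel F"
    using s by (subst (asm) lborel_integrable_real_affine_iff) auto
  have "(\<integral>y. std_normal_density y *\<^sub>R iexp ((- (s * a)) * y) \<partial>lborel) = char std_normal_distribution (- (s * a))"
    unfolding char_def by (subst integral_density) auto
  also have "\<dots> = complex_of_real (exp (- (s * a)\<^sup>2 / 2))"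
    by (simp add: char_std_normal_distribution)
  finally have e: "(\<integral>y. F (0 + s * y) \<partial>lborel) = complex_of_real (sqrt (2 * pi) * exp (- (s * a)\<^sup>2 / 2))"
    unfolding Fs integral_mult_right_zero by simp
  have "integral\<^sup>L lborel F = \<bar>s\<bar> *\<^sub>R (\<integral>y. F (0 + s * y) \<partial>lborel)"
    using s by (intro lborel_integral_real_affine) auto
  also have "\<dots> = complex_of_real (s * sqrt (2 * pi) * exp (- (s * a)\<^sup>2 / 2))"
    unfolding e using s by (simp add: scaleR_conv_of_real)
  also have "s * sqrt (2 * pi) = sqrt (pi * u)"
    unfolding s_def by (simp add: real_sqrt_mult[symmetric])
  also have "- (s * a)\<^sup>2 / 2 = - (u * a\<^sup>2 / 4)"
    using s by (simp add: power_mult_distrib)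
  finally show "integral\<^sup>L lborel F = complex_of_real (sqrt (pi * u) * exp (- (u * a\<^sup>2 / 4)))" .
qed

text \<open>Fubini for functions that split along the coordinates: Lebesgue measure is the image of the product
  of one-dimensional Lebesgue measures.\<close>

lemma lborel_integral_prod_Basis:
  fixes f :: "'a::euclidean_space \<Rightarrow> real \<Rightarrow> complex"
  assumes f: "\<And>b. b \<in> Basis \<Longrightarrow> integrable lborel (f b)"
  shows "integrable lborel (\<lambda>x. \<Prod>b\<in>Basis. f b (x \<bullet> b))"
    and "(\<integral>x. (\<Prod>b\<in>Basis. f b (x \<bullet> b)) \<partial>lborel) = (\<Prod>b\<in>Basis. \<integral>x. f b x \<partial>lborel)"
proof -
  interpret product_sigma_finite "\<lambda>b::'a. lborel :: real measure" ..
  have m [measurable]: "\<And>b. b \<in> Basis \<Longrightarrow> f b \<in> borel_measurable borel"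
    using f by (auto dest!: borel_measurable_integrable)
  have *: "(\<lambda>x::'a. \<Prod>b\<in>Basis. f b (x \<bullet> b)) \<in> borel_measurable borel" by measurable
  have eq: "(\<lambda>x. \<Prod>b\<in>Basis. f b ((\<Sum>c\<in>Basis. x c *\<^sub>R c) \<bullet> b)) = (\<lambda>x. \<Prod>b\<in>Basis. f b (x b))"
    by (simp)
  have D: "(lborel :: 'a measure) =
      distr (Pi\<^sub>M Basis (\<lambda>b. lborel)) borel (\<lambda>x. \<Sum>b\<in>Basis. x b *\<^sub>R b)"
    by (subst lborel_def) (simp add: lborel_eq_real)
  show "integrable lborel (\<lambda>x. \<Prod>b\<in>Basis. f b (x \<bullet> b))"
    unfolding D by (subst integrable_distr_eq) (auto simp: * eq intro!: product_integrable_prod f)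
  show "(\<integral>x. (\<Prod>b\<in>Basis. f b (x \<bullet> b)) \<partial>lborel) = (\<Prod>b\<in>Basis. \<integral>x. f b x \<partial>lborel)"
    unfolding D by (subst integral_distr) (auto simp: * eq intro!: product_integral_prod f)
qed

lemma gaussian_fourier:
  fixes v :: "'a::euclidean_space" and u :: real
  assumes "u > 0"
  shows "integrable lborel (\<lambda>\<xi>. exp (- (\<i> * complex_of_real (\<xi> \<bullet> v))) * exp (- complex_of_real ((norm \<xi>)\<^sup>2 / u)))"
    and "(\<integral>\<xi>. exp (- (\<i> * complex_of_real (\<xi> \<bullet> v))) * exp (- complex_of_real ((norm \<xi>)\<^sup>2 / u)) \<partial>lborel) =
           complex_of_real ((pi * u) powr (real DIM('a) / 2) * exp (- (u * (norm v)\<^sup>2 / 4)))"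
proof -
  define f where "f b x = exp (- (\<i> * complex_of_real (x * (v \<bullet> b)))) * exp (- complex_of_real (x\<^sup>2 / u))" for b and x :: real
  have n: "(norm x)\<^sup>2 = (\<Sum>b\<in>Basis. (x \<bullet> b)\<^sup>2)" for x :: 'a
    unfolding power2_norm_eq_inner by (subst euclidean_inner) (simp add: power2_eq_square)
  have eq: "exp (- (\<i> * complex_of_real (\<xi> \<bullet> v))) * exp (- complex_of_real ((norm \<xi>)\<^sup>2 / u)) =
     (\<Prod>b\<in>Basis. f b (\<xi> \<bullet> b))" for \<xi>
    unfolding f_def prod.distrib
    by (simp add: exp_sum[symmetric] n sum_negf sum_divide_distrib sum_distrib_left euclidean_inner[of \<xi> v])
  have F: "integrable lborel (f b)"
    "(\<integral>x. f b x \<partial>lborel) = complex_of_real (sqrt (pi * u) * exp (- (u * (v \<bullet> b)\<^sup>2 / 4)))" for b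
    using gaussian_fourier_real[OF assms, of "v \<bullet> b"] unfolding f_def by blast+
  show "integrable lborel (\<lambda>\<xi>. exp (- (\<i> * complex_of_real (\<xi> \<bullet> v))) * exp (- complex_of_real ((norm \<xi>)\<^sup>2 / u)))"
    unfolding eq by (rule lborel_integral_prod_Basis) (rule F)
  have "(\<integral>\<xi>. exp (- (\<i> * complex_of_real (\<xi> \<bullet> v))) * exp (- complex_of_real ((norm \<xi>)\<^sup>2 / u)) \<partial>lborel) =
     (\<Prod>b\<in>Basis. complex_of_real (sqrt (pi * u) * exp (- (u * (v \<bullet> b)\<^sup>2 / 4))))"
    unfolding eq by (subst lborel_integral_prod_Basis(2)[OF F(1)]) (simp only: F(2))
  also have "\<dots> = complex_of_real (sqrt (pi * u) ^ DIM('a) * exp (\<Sum>b\<in>Basis. - (u * (v \<bullet> b)\<^sup>2 / 4)))"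
    unfolding of_real_prod[symmetric] prod.distrib by (simp add: exp_sum)
  also have "(\<Sum>b\<in>Basis. - (u * (v \<bullet> b)\<^sup>2 / 4)) = - (u * (norm v)\<^sup>2 / 4)"
    by (simp add: n sum_negf sum_distrib_left sum_divide_distrib)
  also have "sqrt (pi * u) ^ DIM('a) = (pi * u) powr (real DIM('a) / 2)"
    using assms by (simp add: powr_half_sqrt[symmetric] powr_realpow[symmetric] powr_powr)
  finally show "(\<integral>\<xi>. exp (- (\<i> * complex_of_real (\<xi> \<bullet> v))) * exp (- complex_of_real ((norm \<xi>)\<^sup>2 / u)) \<partial>lborel) =
           complex_of_real ((pi * u) powr (real DIM('a) / 2) * exp (- (u * (norm v)\<^sup>2 / 4)))" .
qed

section \<open>Binomial differences and mean values\<close>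

lemma binomial_difference_Suc:
  fixes f :: "nat \<Rightarrow> 'b::comm_ring_1"
  shows "(\<Sum>m\<le>Suc k. of_nat (Suc k choose m) * (- 1) ^ (Suc k - m) * f m) =
         (\<Sum>m\<le>k. of_nat (k choose m) * (- 1) ^ (k - m) * (f (Suc m) - f m))"
proof -
  have "(\<Sum>m\<le>Suc k. of_nat (Suc k choose m) * (- 1) ^ (Suc k - m) * f m) =
     (- 1) ^ Suc k * f 0 + (\<Sum>m\<le>k. of_nat (Suc k choose Suc m) * (- 1) ^ (k - m) * f (Suc m))"
    by (subst sum.atMost_Suc_shift) simp
  also have "(\<Sum>m\<le>k. of_nat (Suc k choose Suc m) * (- 1) ^ (k - m) * f (Suc m)) =
     (\<Sum>m\<le>k. of_nat (k choose m) * (- 1) ^ (k - m) * f (Suc m)) +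
     (\<Sum>m\<le>k. of_nat (k choose Suc m) * (- 1) ^ (k - m) * f (Suc m))"
    by (simp add: sum.distrib[symmetric] algebra_simps)
  also have "(\<Sum>m\<le>k. of_nat (k choose Suc m) * (- 1) ^ (k - m) * f (Suc m)) =
     (\<Sum>m<k. of_nat (k choose Suc m) * (- 1) ^ (k - m) * f (Suc m))"
    by (simp add: lessThan_Suc_atMost[symmetric] binomial_eq_0)
  also have "\<dots> = - (\<Sum>m<k. of_nat (k choose Suc m) * (- 1) ^ (k - Suc m) * f (Suc m))"
    unfolding sum_negf[symmetric]
  proof (intro sum.cong refl)
    fix m assume "m \<in> {..<k}"
    then have "k - m = Suc (k - Suc m)" by auto
    then show "of_nat (k choose Suc m) * (- 1) ^ (k - m) * f (Suc m) =
        - (of_nat (k choose Suc m) * (- 1) ^ (k - Suc m) * f (Suc m))" by simp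
  qed
  also have "(- 1) ^ Suc k * f 0 + ((\<Sum>m\<le>k. of_nat (k choose m) * (- 1) ^ (k - m) * f (Suc m)) +
       - (\<Sum>m<k. of_nat (k choose Suc m) * (- 1) ^ (k - Suc m) * f (Suc m))) =
     (\<Sum>m\<le>k. of_nat (k choose m) * (- 1) ^ (k - m) * f (Suc m)) -
     (\<Sum>m\<le>k. of_nat (k choose m) * (- 1) ^ (k - m) * f m)"
    using sum.lessThan_Suc_shift[of "\<lambda>m. of_nat (k choose m) * (- 1) ^ (k - m) * f m" k]
    by (simp add: lessThan_Suc_atMost)
  finally show ?thesis by (simp add: sum_subtractf[symmetric] algebra_simps)
qed

text \<open>By induction on the order: the difference \<open>g x = f (x + 1) - f x\<close> satisfies the same hypotheses, so its
  iterated difference is a value \<open>f' (c + 1) - f' c\<close>, with \<open>f'\<close> the derivative of \<open>f\<close> of that order, and the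
  ordinary mean value theorem raises the order by one. Only continuity is asked at the left endpoint,
  because \<open>x powr \<alpha>\<close> need not be differentiable at \<open>0\<close>.\<close>

lemma iterated_difference_mean_value:
  fixes f :: "nat \<Rightarrow> real \<Rightarrow> real" and a :: real
  assumes "continuous_on {a..} (f 0)"
    and "\<And>j x. a < x \<Longrightarrow> (f j has_field_derivative f (Suc j) x) (at x)"
  shows "\<exists>c>a. (\<Sum>m\<le>Suc k. real (Suc k choose m) * (- 1) ^ (Suc k - m) * f 0 (a + real m)) = f (Suc k) c"
  using assms
proof (induction k arbitrary: f)
  case 0
  have "\<exists>l z. a < z \<and> z < a + 1 \<and> DERIV (f 0) z :> l \<and> f 0 (a + 1) - f 0 a = (a + 1 - a) * l"
    by (rule MVT) (use 0 in \<open>auto intro: continuous_on_subset simp: real_differentiable_def\<close>)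
  then obtain l z where z: "a < z" "DERIV (f 0) z :> l" "f 0 (a + 1) - f 0 a = l" by auto
  moreover have "l = f 1 z" using DERIV_unique[OF z(2) 0(2)[OF z(1)]] by simp
  ultimately show ?case by auto
next
  case (Suc k)
  define g where "g j x = f j (x + 1) - f j x" for j x
  have "\<exists>c>a. (\<Sum>m\<le>Suc k. real (Suc k choose m) * (- 1) ^ (Suc k - m) * g 0 (a + real m)) = g (Suc k) c"
  proof (rule Suc.IH)
    have "continuous_on {a..} (\<lambda>x. f 0 (x + 1))"
      by (rule continuous_on_compose2[OF Suc.prems(1)]) (auto intro!: continuous_intros)
    then show "continuous_on {a..} (g 0)"
      unfolding g_def by (intro continuous_intros Suc.prems(1))
    fix j and x :: real assume x: "a < x"
    have "((\<lambda>x. f j (x + 1)) has_field_derivative f (Suc j) (x + 1)) (at x)"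
      using x by (subst DERIV_shift[symmetric]) (intro Suc.prems(2), simp)
    then show "(g j has_field_derivative g (Suc j) x) (at x)"
      unfolding g_def by (intro DERIV_diff Suc.prems(2) x)
  qed
  then obtain c where c: "c > a"
    "(\<Sum>m\<le>Suc k. real (Suc k choose m) * (- 1) ^ (Suc k - m) * g 0 (a + real m)) = g (Suc k) c"
    by blast
  obtain z where z: "c < z" "f (Suc k) (c + 1) - f (Suc k) c = (c + 1 - c) * f (Suc (Suc k)) z"
    using MVT2[of c "c + 1" "f (Suc k)" "f (Suc (Suc k))"] Suc.prems(2) c(1) by force
  have "(\<Sum>m\<le>Suc (Suc k). real (Suc (Suc k) choose m) * (- 1) ^ (Suc (Suc k) - m) * f 0 (a + real m)) =
     f (Suc (Suc k)) z"
    using binomial_difference_Suc[of "Suc k" "\<lambda>m. f 0 (a + real m)"] c(2) z(2)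
    by (simp add: g_def add_ac)
  with z(1) c(1) show ?case by (intro exI[of _ z]) simp
qed

text \<open>\<open>S_const k \<alpha>\<close> is the \<open>k\<close>-th difference of \<open>x powr \<alpha>\<close> at \<open>0\<close>. The product exhibits exactly which
  exponents make it vanish, and so serves both for the nonvanishing of \<open>S_const\<close> and for the vanishing
  of the low moments of the binomial coefficients.\<close>

lemma S_const_mean_value:
  assumes "\<alpha> > 0" "k > 0"
  shows "\<exists>c>0. S_const k \<alpha> = (\<Prod>l<k. \<alpha> - real l) * c powr (\<alpha> - real k)"
proof -
  define f where "f j x = (\<Prod>l<j. \<alpha> - real l) * x powr (\<alpha> - real j)" for j and x :: real
  obtain k' where k: "k = Suc k'" using assms by (cases k) auto
  have "\<exists>c>0. (\<Sum>m\<le>Suc k'. real (Suc k' choose m) * (- 1) ^ (Suc k' - m) * f 0 (0 + real m)) = f (Suc k') c"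
  proof (rule iterated_difference_mean_value)
    show "continuous_on {0..} (f 0)"
      unfolding f_def using assms
      by (intro continuous_on_mult continuous_on_const continuous_on_powr' continuous_on_id) auto
    show "(f j has_field_derivative f (Suc j) x) (at x)" if "0 < x" for j x
      unfolding f_def using that
      by (auto intro!: derivative_eq_intros simp: algebra_simps)
  qed
  moreover have "S_const k \<alpha> = (\<Sum>m\<le>k. real (k choose m) * (- 1) ^ (k - m) * real m powr \<alpha>)"
    unfolding S_const_def using assms
    by (intro sum.mono_neutral_left) (auto simp: not_less_eq_eq Suc_le_eq)
  ultimately show ?thesis by (simp add: f_def k)
qed

corollary S_const_nonzero:
  assumes "\<alpha> > 0" "k > 0" "\<alpha> \<notin> \<int> \<or> \<alpha> \<ge> real k"
  shows "S_const k \<alpha> \<noteq> 0"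
proof -
  obtain c where c: "c > 0" "S_const k \<alpha> = (\<Prod>l<k. \<alpha> - real l) * c powr (\<alpha> - real k)"
    using S_const_mean_value assms by blast
  have "\<alpha> \<noteq> real l" if "l < k" for l using assms(3) that by auto
  then show ?thesis using c by (auto simp: prod_zero_iff)
qed

corollary binomial_difference_power_eq_0:
  assumes "j < k"
  shows "(\<Sum>m\<le>k. real (k choose m) * (- 1) ^ (k - m) * real m ^ j) = 0"
proof (cases "j = 0")
  case True
  have "(\<Sum>m\<le>k. real (k choose m) * (1::real) ^ m * (- 1) ^ (k - m)) = (1 + - 1) ^ k"
    by (rule binomial_ring[symmetric])
  then show ?thesis using True assms by simp
next
  case False
  obtain c where c: "c > 0" "S_const k (real j) = (\<Prod>l<k. real j - real l) * c powr (real j - real k)"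
    using S_const_mean_value[of "real j" k] False assms by auto
  have "(\<Prod>l<k. real j - real l) = 0" using assms by (auto simp: prod_zero_iff)
  then have "S_const k (real j) = 0" using c by simp
  moreover have "S_const k (real j) = (\<Sum>m\<le>k. real (k choose m) * (- 1) ^ (k - m) * real m ^ j)"
    unfolding S_const_def using False
    by (intro sum.mono_neutral_cong_left) (auto simp: Suc_le_eq powr_realpow)
  ultimately show ?thesis by simp
qed

section \<open>Gamma function identities and the constant\<close>

lemma Gamma_reflection_half:
  fixes \<alpha> :: real
  shows "Gamma (- \<alpha> / 2) * Gamma (\<alpha> / 2 + 1) = - pi / sin (\<alpha> * pi / 2)"
proof -
  have "complex_of_real (Gamma (- \<alpha> / 2) * Gamma (1 - (- \<alpha> / 2))) = complex_of_real (pi / sin (pi * (- \<alpha> / 2)))"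
    using Gamma_reflection_complex[of "complex_of_real (- \<alpha> / 2)"]
    unfolding of_real_mult of_real_divide[of pi] sin_of_real[symmetric] Gamma_complex_of_real[symmetric]
    by (simp only: of_real_mult of_real_diff of_real_1)
  then have "Gamma (- \<alpha> / 2) * Gamma (1 - (- \<alpha> / 2)) = pi / sin (pi * (- \<alpha> / 2))"
    by (simp only: of_real_eq_iff)
  then show ?thesis by (simp add: mult.commute add.commute)
qed

lemma Gamma_duplication_half:
  fixes \<alpha> :: real
  assumes "\<alpha> > 0"
  shows "Gamma ((\<alpha> + 1) / 2) * Gamma (\<alpha> / 2 + 1) = 2 powr (- \<alpha>) * sqrt pi * Gamma (\<alpha> + 1)"
proof -
  define z where "z = (\<alpha> + 1) / 2"
  have z: "z > 0" "z + 1 / 2 = \<alpha> / 2 + 1" "2 * z = \<alpha> + 1"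
    using assms by (auto simp: z_def field_simps)
  have "complex_of_real z \<notin> \<int>\<^sub>\<le>\<^sub>0" "complex_of_real z + 1 / 2 \<notin> \<int>\<^sub>\<le>\<^sub>0"
    using z(1) by (auto elim!: nonpos_Ints_cases simp: complex_eq_iff)
  note D = Gamma_legendre_duplication[OF this]
  have "complex_of_real z + 1 / 2 = complex_of_real (z + 1 / 2)" by simp
  then have e1: "complex_of_real z + 1 / 2 = complex_of_real (\<alpha> / 2 + 1)" by (simp only: z(2))
  have "2 * complex_of_real z = complex_of_real (2 * z)" by simp
  then have e2: "2 * complex_of_real z = complex_of_real (\<alpha> + 1)" by (simp only: z(3))
  have e3: "(1 - complex_of_real (\<alpha> + 1)) * complex_of_real (ln 2) = complex_of_real (- \<alpha> * ln 2)"
    by simp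
  have "complex_of_real (Gamma z * Gamma (\<alpha> / 2 + 1)) = complex_of_real (exp (- \<alpha> * ln 2) * sqrt pi * Gamma (\<alpha> + 1))"
    using D[unfolded e1 e2 e3] by (simp only: Gamma_complex_of_real exp_of_real[symmetric] of_real_mult)
  then have "Gamma z * Gamma (\<alpha> / 2 + 1) = exp (- \<alpha> * ln 2) * sqrt pi * Gamma (\<alpha> + 1)"
    by (simp only: of_real_eq_iff)
  then show ?thesis by (simp add: z_def powr_def)
qed

text \<open>The integral over \<open>\<xi>\<close> of the real part of \<open>(exp (- \<i> (\<xi> \<bullet> v)) - 1)^k / \<bar>\<xi>\<bar>^(d+\<alpha>)\<close>, for a unit vector \<open>v\<close>
  and \<open>\<alpha>\<close> as in the moment formulas, in the form in which it comes out of the Mellin transform.\<close>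

definition kernel_const :: "nat \<Rightarrow> real \<Rightarrow> nat \<Rightarrow> real" where
  "kernel_const k \<alpha> d =
     pi powr (real d / 2) * Gamma (- \<alpha> / 2) * S_const k \<alpha> / (2 powr \<alpha> * Gamma ((real d + \<alpha>) / 2))"

text \<open>Cancelling \<open>S(k,\<alpha>)\<close> and the dimension-dependent factors leaves
  \<open>- sin (\<alpha>\<pi>/2) \<Gamma>(\<alpha>+1) \<Gamma>(-\<alpha>/2) / (sqrt \<pi> 2^\<alpha> \<Gamma>((\<alpha>+1)/2))\<close>. Duplication expresses \<open>\<Gamma>(\<alpha>+1)\<close> through
  \<open>\<Gamma>((\<alpha>+1)/2) \<Gamma>(\<alpha>/2+1)\<close>, and reflection evaluates \<open>\<Gamma>(-\<alpha>/2) \<Gamma>(\<alpha>/2+1)\<close>.\<close>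

lemma A_const_kernel_const:
  assumes "\<alpha> > 0" "S_const k \<alpha> \<noteq> 0" "sin (\<alpha> * pi / 2) \<noteq> 0"
  shows "A_const k \<alpha> d * kernel_const k \<alpha> d = 1"
proof -
  define G1 where "G1 = Gamma ((\<alpha> + 1) / 2)"
  define G2 where "G2 = Gamma (\<alpha> / 2 + 1)"
  define G3 where "G3 = Gamma (- \<alpha> / 2)"
  define G4 where "G4 = Gamma ((\<alpha> + real d) / 2)"
  define G5 where "G5 = Gamma (\<alpha> + 1)"
  define w where "w = sin (\<alpha> * pi / 2)"
  define S where "S = S_const k \<alpha>"
  define D where "D = pi powr (real d / 2)"
  define T where "T = 2 powr \<alpha>"
  have pos: "G1 > 0" "G2 > 0" "G4 > 0" "G5 > 0" "D > 0" "T > 0"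
    using assms by (auto simp: G1_def G2_def G4_def G5_def D_def T_def intro!: Gamma_real_pos add_pos_nonneg)
  have nz: "S \<noteq> 0" "w \<noteq> 0" using assms by (auto simp: S_def w_def)
  have r: "G3 * G2 = - pi / w"
    using Gamma_reflection_half[of \<alpha>] by (simp only: G3_def G2_def w_def)
  have dup: "T * (G1 * G2) = sqrt pi * G5"
    using Gamma_duplication_half[OF assms(1)] pos
    by (simp add: G1_def G2_def G5_def T_def powr_minus field_simps)
  have D1: "pi powr ((real d + 1) / 2) = D * sqrt pi"
    by (simp add: D_def add_divide_distrib powr_add powr_half_sqrt)
  have "A_const k \<alpha> d * kernel_const k \<alpha> d =
      - (w * G5 * G4) / (D * sqrt pi * S * G1) * (D * G3 * S / (T * G4))"
    unfolding A_const_def kernel_const_def D1 G1_def G3_def G4_def G5_def w_def S_def D_def T_def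
    by (simp only: add.commute[of "real d" \<alpha>])
  also have "\<dots> = - (w * G5 * G3) / (sqrt pi * G1 * T)"
    using pos nz by (simp add: field_simps)
  also have "\<dots> = - (w * (sqrt pi * G5) * (G3 * G2)) / (sqrt pi * sqrt pi * (T * (G1 * G2)))"
    using pos by (simp add: field_simps)
  also have "\<dots> = - (w * (- pi / w)) / (sqrt pi * sqrt pi)"
    unfolding r dup using pos by (simp add: field_simps)
  also have "\<dots> = 1" using nz by simp
  finally show ?thesis .
qed

lemma sin_half_pi_nonzero:
  fixes \<alpha> :: real
  assumes "\<alpha> \<notin> \<int> \<or> (odd k \<and> \<alpha> = real k)"
  shows "sin (\<alpha> * pi / 2) \<noteq> 0"
proof
  assume "sin (\<alpha> * pi / 2) = 0"
  then obtain i :: int where "\<alpha> * pi / 2 = of_int i * pi" by (auto simp: sin_zero_iff_int2)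
  then have a: "\<alpha> = of_int (2 * i)" by simp
  then have "\<alpha> \<in> \<int>" by simp
  with assms have "odd k" "real k = of_int (2 * i)" using a by auto
  then have "int k = 2 * i" by linarith
  with \<open>odd k\<close> show False by presburger
qed

section \<open>Integrating a ridge function against a homogeneous kernel\<close>

lemma nn_integral_gaussian:
  assumes "u > 0"
  shows "(\<integral>\<^sup>+ (\<xi>::'a::euclidean_space). ennreal (exp (- ((norm \<xi>)\<^sup>2 / u))) \<partial>lborel) =
           ennreal ((pi * u) powr (real DIM('a) / 2))"
proof -
  have eq: "exp (- (\<i> * complex_of_real (\<xi> \<bullet> 0))) * exp (- complex_of_real ((norm \<xi>)\<^sup>2 / u)) =
        complex_of_real (exp (- ((norm \<xi>)\<^sup>2 / u)))" for \<xi> :: 'a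
    by (simp add: exp_of_real[symmetric])
  note G = gaussian_fourier[OF assms, of "0::'a", unfolded eq]
  have i: "integrable lborel (\<lambda>\<xi>::'a. exp (- ((norm \<xi>)\<^sup>2 / u)))"
    using G(1) by (simp only: complex_of_real_integrable_eq)
  have "(\<integral>(\<xi>::'a). exp (- ((norm \<xi>)\<^sup>2 / u)) \<partial>lborel) = (pi * u) powr (real DIM('a) / 2)"
    using G(2) unfolding integral_complex_of_real of_real_eq_iff by simp
  with i show ?thesis by (subst nn_integral_eq_integral) auto
qed

text \<open>From \<open>x^p / p! \<le> exp x\<close> and \<open>x \<le> 1/2 + x\<^sup>2/2\<close>. It lets half of a Gaussian absorb a power of the norm,
  which bounds Gaussian moments in any dimension without computing them.\<close>

lemma power_le_fact_exp:
  fixes x :: real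
  assumes "x \<ge> 0"
  shows "x ^ p \<le> fact p * exp (1 / 2) * exp (x\<^sup>2 / 2)"
proof -
  have "x ^ p / fact p \<le> exp x"
    using sum_le_suminf[OF summable_exp_generic[of x], of "{p}"] assms
    by (simp add: exp_def divide_inverse mult.commute)
  also have "x \<le> 1 / 2 + x\<^sup>2 / 2" using sum_squares_ge_zero[of "x - 1" 0] by (simp add: power2_eq_square algebra_simps)
  finally have "x ^ p / fact p \<le> exp (1 / 2) * exp (x\<^sup>2 / 2)" by (simp add: exp_add)
  then show ?thesis by (simp add: field_simps)
qed

lemma nn_integral_gaussian_moment:
  assumes u: "u > 0"
  shows "(\<integral>\<^sup>+ (\<xi>::'a::euclidean_space). ennreal (norm \<xi> ^ p * exp (- ((norm \<xi>)\<^sup>2 / u))) \<partial>lborel) \<le>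
           ennreal (fact p * exp (1 / 2) * (2 * pi) powr (real DIM('a) / 2) * u powr ((real p + real DIM('a)) / 2))"
proof -
  have "(\<integral>\<^sup>+ (\<xi>::'a). ennreal (norm \<xi> ^ p * exp (- ((norm \<xi>)\<^sup>2 / u))) \<partial>lborel) \<le>
     (\<integral>\<^sup>+ (\<xi>::'a). ennreal (fact p * exp (1 / 2) * u powr (real p / 2)) * ennreal (exp (- ((norm \<xi>)\<^sup>2 / (2 * u)))) \<partial>lborel)"
  proof (rule nn_integral_mono)
    fix \<xi> :: 'a
    define x where "x = norm \<xi> / sqrt u"
    have x: "x \<ge> 0" "norm \<xi> = x * sqrt u" using u by (auto simp: x_def)
    have n2: "(norm \<xi>)\<^sup>2 / u = x\<^sup>2" using u by (simp add: x(2) power_mult_distrib)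
    have su: "sqrt u ^ p = u powr (real p / 2)"
      using u by (simp add: powr_half_sqrt[symmetric] powr_realpow[symmetric] powr_powr)
    have "norm \<xi> ^ p * exp (- ((norm \<xi>)\<^sup>2 / u)) = x ^ p * u powr (real p / 2) * exp (- x\<^sup>2)"
      unfolding n2 by (simp add: x(2) power_mult_distrib su)
    also have "\<dots> \<le> (fact p * exp (1 / 2) * exp (x\<^sup>2 / 2)) * u powr (real p / 2) * exp (- x\<^sup>2)"
      by (intro mult_right_mono power_le_fact_exp x) auto
    also have "\<dots> = (fact p * exp (1 / 2) * u powr (real p / 2)) * (exp (x\<^sup>2 / 2) * exp (- x\<^sup>2))"
      by (simp only: mult_ac)
    also have "exp (x\<^sup>2 / 2) * exp (- x\<^sup>2) = exp (- (x\<^sup>2 / 2))"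
      by (simp add: exp_add[symmetric])
    also have "x\<^sup>2 / 2 = (norm \<xi>)\<^sup>2 / (2 * u)" unfolding n2[symmetric] by simp
    finally show "ennreal (norm \<xi> ^ p * exp (- ((norm \<xi>)\<^sup>2 / u))) \<le>
       ennreal (fact p * exp (1 / 2) * u powr (real p / 2)) * ennreal (exp (- ((norm \<xi>)\<^sup>2 / (2 * u))))"
      by (subst ennreal_mult[symmetric]) (auto intro!: ennreal_leI)
  qed
  also have "\<dots> = ennreal (fact p * exp (1 / 2) * u powr (real p / 2)) * ennreal ((pi * (2 * u)) powr (real DIM('a) / 2))"
    using u by (subst nn_integral_cmult) (auto simp: nn_integral_gaussian)
  also have "\<dots> = ennreal (fact p * exp (1 / 2) * (2 * pi) powr (real DIM('a) / 2) * u powr ((real p + real DIM('a)) / 2))"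
    using u by (subst ennreal_mult[symmetric]) (auto simp: powr_mult powr_add add_divide_distrib mult_ac)
  finally show ?thesis .
qed

text \<open>The common setting for \<open>h(s) = (exp (- \<i> s) - 1)^k\<close> and its real part. The two bounds are what makes
  \<open>h(\<xi> \<bullet> v) / \<bar>\<xi>\<bar>^(d+\<alpha>)\<close> integrable, at infinity and at the origin respectively.\<close>

locale ridge_kernel =
  fixes h :: "real \<Rightarrow> complex" and K :: real and p :: nat and \<alpha> :: real
  assumes measurable_h [measurable]: "h \<in> borel_measurable borel"
    and bounded: "norm (h s) \<le> K"
    and small: "norm (h s) \<le> K * \<bar>s\<bar> ^ p"
    and exponent: "0 < \<alpha>" "\<alpha> < real p"
begin

lemma K_nonneg: "K \<ge> 0"
  using bounded[of 0] norm_ge_zero order_trans by blast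

lemma vanishes_at_0: "h 0 = 0"
  using small[of 0] exponent by (simp add: zero_power)

text \<open>The constant collected in the bound for the integral of \<open>joint\<close> below: the first summand
  comes from \<open>u \<ge> 1/\<bar>v\<bar>\<^sup>2\<close>, the second from \<open>u \<le> 1/\<bar>v\<bar>\<^sup>2\<close>.\<close>

definition bound_const :: "nat \<Rightarrow> real" where
  "bound_const d = K * pi powr (real d / 2) * 2 / \<alpha> +
         K * (fact p * exp (1 / 2) * (2 * pi) powr (real d / 2)) * 2 / (real p - \<alpha>)"

lemma bound_const_nonneg: "bound_const d \<ge> 0"
  unfolding bound_const_def using K_nonneg exponent by (intro add_nonneg_nonneg divide_nonneg_nonneg mult_nonneg_nonneg) auto

text \<open>The integrand on \<open>(u, \<xi>)\<close>-space that gives \<open>h(\<xi> \<bullet> v) / \<bar>\<xi>\<bar>^(d+\<alpha>)\<close>, up to \<open>\<Gamma>((d+\<alpha>)/2)\<close>, when \<open>u\<close> is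
  integrated out.\<close>

definition joint :: "'a::euclidean_space \<Rightarrow> real \<Rightarrow> 'a \<Rightarrow> complex" where
  "joint v u \<xi> = h (\<xi> \<bullet> v) *
     complex_of_real (indicator {0<..} u * (u powr (- ((real DIM('a) + \<alpha>) / 2) - 1) * exp (- ((norm \<xi>)\<^sup>2 / u))))"

lemma measurable_joint: "(\<lambda>(u, \<xi>). joint v u \<xi>) \<in> borel_measurable (lborel \<Otimes>\<^sub>M lborel)"
  unfolding joint_def by measurable

text \<open>The first bound uses \<open>\<bar>h\<bar> \<le> K\<close>, the second \<open>\<bar>h(\<xi> \<bullet> v)\<bar> \<le> K (\<bar>\<xi>\<bar> \<bar>v\<bar>)^p\<close>. As functions of \<open>u\<close> they are
  integrable at infinity and at \<open>0\<close>, respectively.\<close>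

lemma nn_integral_slice_bounds:
  fixes v :: "'a::euclidean_space"
  assumes u: "u > 0"
  shows "(\<integral>\<^sup>+ \<xi>. norm (joint v u \<xi>) \<partial>lborel) \<le>
           ennreal (K * pi powr (real DIM('a) / 2) * u powr (- (\<alpha> / 2) - 1))" (is "?I \<le> _")
    and "(\<integral>\<^sup>+ \<xi>. norm (joint v u \<xi>) \<partial>lborel) \<le>
           ennreal (K * (fact p * exp (1 / 2) * (2 * pi) powr (real DIM('a) / 2)) * norm v ^ p *
             u powr ((real p - \<alpha>) / 2 - 1))"
proof -
  define e where "e = - ((real DIM('a) + \<alpha>) / 2) - 1"
  have n: "norm (joint v u \<xi>) = norm (h (\<xi> \<bullet> v)) * (u powr e * exp (- ((norm \<xi>)\<^sup>2 / u)))" for \<xi>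
    using u by (simp add: joint_def norm_mult e_def)
  have "?I \<le> (\<integral>\<^sup>+ (\<xi>::'a). ennreal (K * u powr e) * ennreal (exp (- ((norm \<xi>)\<^sup>2 / u))) \<partial>lborel)"
  proof (rule nn_integral_mono)
    fix \<xi> :: 'a
    have "norm (joint v u \<xi>) \<le> K * (u powr e * exp (- ((norm \<xi>)\<^sup>2 / u)))"
      unfolding n by (intro mult_right_mono bounded) auto
    then show "ennreal (norm (joint v u \<xi>)) \<le> ennreal (K * u powr e) * ennreal (exp (- ((norm \<xi>)\<^sup>2 / u)))"
      by (subst ennreal_mult[symmetric]) (use K_nonneg in \<open>auto intro!: ennreal_leI simp: mult_ac\<close>)
  qed
  also have "\<dots> = ennreal (K * u powr e) * ennreal ((pi * u) powr (real DIM('a) / 2))"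
    using u by (subst nn_integral_cmult) (auto simp: nn_integral_gaussian)
  also have "\<dots> = ennreal (K * u powr e * (pi * u) powr (real DIM('a) / 2))"
    using K_nonneg by (subst ennreal_mult) auto
  also have "K * u powr e * (pi * u) powr (real DIM('a) / 2) = K * pi powr (real DIM('a) / 2) * (u powr e * u powr (real DIM('a) / 2))"
    using u by (simp add: powr_mult)
  also have "u powr e * u powr (real DIM('a) / 2) = u powr (- (\<alpha> / 2) - 1)"
    by (simp add: powr_add[symmetric] e_def field_simps)
  finally show "?I \<le> ennreal (K * pi powr (real DIM('a) / 2) * u powr (- (\<alpha> / 2) - 1))" .
  let ?M = "fact p * exp (1 / 2) * (2 * pi) powr (real DIM('a) / 2)"
  have "?I \<le> (\<integral>\<^sup>+ (\<xi>::'a). ennreal (K * u powr e * norm v ^ p) * ennreal (norm \<xi> ^ p * exp (- ((norm \<xi>)\<^sup>2 / u))) \<partial>lborel)"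
  proof (rule nn_integral_mono)
    fix \<xi> :: 'a
    have "norm (h (\<xi> \<bullet> v)) \<le> K * \<bar>\<xi> \<bullet> v\<bar> ^ p" by (rule small)
    also have "\<dots> \<le> K * (norm \<xi> * norm v) ^ p"
      using K_nonneg Cauchy_Schwarz_ineq2[of \<xi> v] by (intro mult_left_mono power_mono) auto
    finally have "norm (joint v u \<xi>) \<le> K * (norm \<xi> * norm v) ^ p * (u powr e * exp (- ((norm \<xi>)\<^sup>2 / u)))"
      unfolding n by (intro mult_right_mono) auto
    then show "ennreal (norm (joint v u \<xi>)) \<le>
        ennreal (K * u powr e * norm v ^ p) * ennreal (norm \<xi> ^ p * exp (- ((norm \<xi>)\<^sup>2 / u)))"
      by (subst ennreal_mult[symmetric]) (use K_nonneg in \<open>auto intro!: ennreal_leI simp: mult_ac power_mult_distrib\<close>)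
  qed
  also have "\<dots> = ennreal (K * u powr e * norm v ^ p) * (\<integral>\<^sup>+ (\<xi>::'a). ennreal (norm \<xi> ^ p * exp (- ((norm \<xi>)\<^sup>2 / u))) \<partial>lborel)"
    using u by (subst nn_integral_cmult) auto
  also have "\<dots> \<le> ennreal (K * u powr e * norm v ^ p) * ennreal (?M * u powr ((real p + real DIM('a)) / 2))"
    by (intro mult_left_mono nn_integral_gaussian_moment u) auto
  also have "\<dots> = ennreal ((K * u powr e * norm v ^ p) * (?M * u powr ((real p + real DIM('a)) / 2)))"
    using K_nonneg by (subst ennreal_mult) auto
  also have "(K * u powr e * norm v ^ p) * (?M * u powr ((real p + real DIM('a)) / 2)) =
      K * ?M * norm v ^ p * (u powr e * u powr ((real p + real DIM('a)) / 2))"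
    by (simp only: mult_ac)
  also have "u powr e * u powr ((real p + real DIM('a)) / 2) = u powr ((real p - \<alpha>) / 2 - 1)"
  proof -
    have "e + (real p + real DIM('a)) / 2 = (real p - \<alpha>) / 2 - 1"
      unfolding e_def by (simp add: diff_divide_distrib add_divide_distrib)
    then show ?thesis by (simp only: powr_add[symmetric])
  qed
  finally show "?I \<le> ennreal (K * ?M * norm v ^ p * u powr ((real p - \<alpha>) / 2 - 1))" .
qed

text \<open>Splitting the \<open>u\<close>-integral at \<open>1/\<bar>v\<bar>\<^sup>2\<close>, where the two slice bounds balance, gives the homogeneous bound
  \<open>\<bar>v\<bar>^\<alpha>\<close>. This dependence on \<open>v\<close> is what later makes the \<open>\<mu>\<close>-integral finite.\<close>

lemma nn_integral_joint_bound:
  fixes v :: "'a::euclidean_space"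
  shows "(\<integral>\<^sup>+ u. (\<integral>\<^sup>+ \<xi>. norm (joint v u \<xi>) \<partial>lborel) \<partial>lborel) \<le> ennreal (bound_const DIM('a) * norm v powr \<alpha>)"
proof (cases "v = 0")
  case True
  then show ?thesis by (simp add: joint_def vanishes_at_0)
next
  case v: False
  \<comment> \<open>The scale at which \<open>\<bar>\<xi> \<bullet> v\<bar>\<close> is of order one for \<open>\<bar>\<xi>\<bar>\<^sup>2\<close> of order \<open>u\<close>.\<close>
  define c where "c = 1 / (norm v)\<^sup>2"
  have c: "c > 0" using v by (simp add: c_def)
  define A where "A = K * pi powr (real DIM('a) / 2)"
  define B where "B = K * (fact p * exp (1 / 2) * (2 * pi) powr (real DIM('a) / 2)) * norm v ^ p"
  have AB: "A \<ge> 0" "B \<ge> 0" using K_nonneg by (auto simp: A_def B_def)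
  have I1: "has_bochner_integral lborel (\<lambda>u. A * (indicator {c..} u * u powr (- (\<alpha> / 2) - 1))) (A * (c powr - (\<alpha> / 2) / (\<alpha> / 2)))"
    using has_bochner_integral_powr_at_infinity[of "\<alpha> / 2" c] exponent c by (intro has_bochner_integral_mult_right) auto
  have I2: "has_bochner_integral lborel (\<lambda>u. B * (indicator {0..c} u * u powr ((real p - \<alpha>) / 2 - 1)))
      (B * (c powr ((real p - \<alpha>) / 2) / ((real p - \<alpha>) / 2)))"
    using has_bochner_integral_powr_at_0[of "(real p - \<alpha>) / 2" c] exponent c by (intro has_bochner_integral_mult_right) auto
  have "(\<integral>\<^sup>+ u. (\<integral>\<^sup>+ \<xi>. norm (joint v u \<xi>) \<partial>lborel) \<partial>lborel) \<le>
     (\<integral>\<^sup>+ u. ennreal (A * (indicator {c..} u * u powr (- (\<alpha> / 2) - 1)) +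
        B * (indicator {0..c} u * u powr ((real p - \<alpha>) / 2 - 1))) \<partial>lborel)"
  proof (rule nn_integral_mono)
    fix u :: real
    consider "u \<le> 0" | "0 < u" "u \<le> c" | "c < u" by linarith
    then show "(\<integral>\<^sup>+ \<xi>. norm (joint v u \<xi>) \<partial>lborel) \<le> ennreal (A * (indicator {c..} u * u powr (- (\<alpha> / 2) - 1)) +
        B * (indicator {0..c} u * u powr ((real p - \<alpha>) / 2 - 1)))"
    proof cases
      case 1
      then show ?thesis by (simp add: joint_def)
    next
      case 2
      have "(\<integral>\<^sup>+ \<xi>. norm (joint v u \<xi>) \<partial>lborel) \<le> ennreal (B * u powr ((real p - \<alpha>) / 2 - 1))"
        unfolding B_def by (rule nn_integral_slice_bounds(2)[OF 2(1)])
      also have "\<dots> \<le> ennreal (A * (indicator {c..} u * u powr (- (\<alpha> / 2) - 1)) +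
        B * (indicator {0..c} u * u powr ((real p - \<alpha>) / 2 - 1)))"
        using 2 AB by (intro ennreal_leI) auto
      finally show ?thesis .
    next
      case 3
      then have "u > 0" using c by simp
      have "(\<integral>\<^sup>+ \<xi>. norm (joint v u \<xi>) \<partial>lborel) \<le> ennreal (A * u powr (- (\<alpha> / 2) - 1))"
        unfolding A_def by (rule nn_integral_slice_bounds(1)[OF \<open>u > 0\<close>])
      then show ?thesis using 3 by simp
    qed
  qed
  also have "\<dots> = ennreal (A * (c powr - (\<alpha> / 2) / (\<alpha> / 2)) + B * (c powr ((real p - \<alpha>) / 2) / ((real p - \<alpha>) / 2)))"
    using has_bochner_integral_add[OF I1 I2] AB
    by (subst nn_integral_eq_integral) (auto simp: has_bochner_integral_iff)
  also have "A * (c powr - (\<alpha> / 2) / (\<alpha> / 2)) + B * (c powr ((real p - \<alpha>) / 2) / ((real p - \<alpha>) / 2)) =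
      bound_const DIM('a) * norm v powr \<alpha>"
  proof -
    have cp: "c = norm v powr (- 2)" using v by (simp add: c_def powr_minus divide_inverse)
    have "c powr - (\<alpha> / 2) = norm v powr \<alpha>" by (simp add: cp powr_powr)
    moreover have "norm v ^ p * c powr ((real p - \<alpha>) / 2) = norm v powr \<alpha>"
    proof -
      have "real p + - 2 * ((real p - \<alpha>) / 2) = \<alpha>" by (simp add: field_simps)
      moreover have "norm v ^ p = norm v powr real p" using v by (simp add: powr_realpow)
      ultimately show ?thesis
        unfolding cp powr_powr by (simp only: powr_add[symmetric])
    qed
    then have "B * c powr ((real p - \<alpha>) / 2) =
        K * (fact p * exp (1 / 2) * (2 * pi) powr (real DIM('a) / 2)) * norm v powr \<alpha>"
      unfolding B_def by (simp only: mult.assoc)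
    ultimately show ?thesis
      unfolding times_divide_eq_right bound_const_def A_def by (simp add: field_simps)
  qed
  finally show ?thesis .
qed

lemma integrable_joint: "integrable (lborel \<Otimes>\<^sub>M lborel) (\<lambda>(u, \<xi>). joint v u \<xi>)"
proof (rule integrableI_bounded)
  have "(\<integral>\<^sup>+ x. norm (case x of (u, \<xi>) \<Rightarrow> joint v u \<xi>) \<partial>(lborel \<Otimes>\<^sub>M lborel)) =
      (\<integral>\<^sup>+ u. (\<integral>\<^sup>+ \<xi>. norm (joint v u \<xi>) \<partial>lborel) \<partial>lborel)"
    using measurable_joint[of v] by (subst lborel.nn_integral_fst[symmetric]) auto
  then show "(\<integral>\<^sup>+ x. norm (case x of (u, \<xi>) \<Rightarrow> joint v u \<xi>) \<partial>(lborel \<Otimes>\<^sub>M lborel)) < \<infinity>"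
    using nn_integral_joint_bound[of v] by (simp add: order_le_less_trans)
qed (rule measurable_joint)

lemma Gamma_subordination:
  fixes \<xi> v :: "'a::euclidean_space"
  assumes "\<xi> \<noteq> 0"
  defines "q \<equiv> real DIM('a) + \<alpha>"
  shows "has_bochner_integral lborel (\<lambda>u. joint v u \<xi>) (complex_of_real (Gamma (q / 2)) * (h (\<xi> \<bullet> v) / complex_of_real (norm \<xi> powr q)))"
    and "(\<integral>\<^sup>+ u. norm (joint v u \<xi>) \<partial>lborel) = ennreal (Gamma (q / 2) * norm (h (\<xi> \<bullet> v) / complex_of_real (norm \<xi> powr q)))"
proof -
  have q: "q / 2 > 0" using exponent by (simp add: q_def add_nonneg_pos)
  have *: "has_bochner_integral lborel (\<lambda>u. indicator {0<..} u * (u powr (- (q / 2) - 1) * exp (- ((norm \<xi>)\<^sup>2 / u))))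
      (Gamma (q / 2) * (norm \<xi>)\<^sup>2 powr - (q / 2))"
    using assms by (intro has_bochner_integral_inverse_Gamma q) auto
  have e: "(norm \<xi>)\<^sup>2 powr - (q / 2) = inverse (norm \<xi> powr q)"
  proof -
    have "norm \<xi> powr 2 = (norm \<xi>)\<^sup>2" by (rule powr_numeral) simp
    moreover have "2 * - (q / 2) = - q" by simp
    then have "(norm \<xi> powr 2) powr - (q / 2) = norm \<xi> powr - q" by (simp only: powr_powr)
    ultimately have "(norm \<xi>)\<^sup>2 powr - (q / 2) = norm \<xi> powr - q" by (simp only:)
    then show ?thesis by (simp only: powr_minus)
  qed
  have **: "has_bochner_integral lborel
      (\<lambda>u. indicator {0<..} u * (u powr (- (q / 2) - 1) * exp (- ((norm \<xi>)\<^sup>2 / u))))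
      (Gamma (q / 2) * inverse (norm \<xi> powr q))"
    using * by (subst e[symmetric])
  show "has_bochner_integral lborel (\<lambda>u. joint v u \<xi>) (complex_of_real (Gamma (q / 2)) * (h (\<xi> \<bullet> v) / complex_of_real (norm \<xi> powr q)))"
  proof -
    have "h (\<xi> \<bullet> v) * complex_of_real (Gamma (q / 2) * inverse (norm \<xi> powr q)) =
        complex_of_real (Gamma (q / 2)) * (h (\<xi> \<bullet> v) / complex_of_real (norm \<xi> powr q))"
      by (simp only: divide_inverse of_real_mult of_real_inverse mult_ac)
    moreover have "(\<lambda>u. joint v u \<xi>) = (\<lambda>u. h (\<xi> \<bullet> v) *
        complex_of_real (indicator {0<..} u * (u powr (- (q / 2) - 1) * exp (- ((norm \<xi>)\<^sup>2 / u)))))"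
      by (simp only: joint_def q_def)
    ultimately show ?thesis
      using has_bochner_integral_mult_right[OF has_bochner_integral_of_real[OF **], of "h (\<xi> \<bullet> v)"]
      by (simp only:)
  qed
  have "(\<integral>\<^sup>+ u. norm (joint v u \<xi>) \<partial>lborel) =
     (\<integral>\<^sup>+ u. norm (h (\<xi> \<bullet> v)) * (indicator {0<..} u * (u powr (- (q / 2) - 1) * exp (- ((norm \<xi>)\<^sup>2 / u)))) \<partial>lborel)"
  proof (intro nn_integral_cong arg_cong[where f=ennreal])
    fix u :: real
    have "norm (complex_of_real (indicator {0<..} u * (u powr (- (q / 2) - 1) * exp (- ((norm \<xi>)\<^sup>2 / u))))) =
       indicator {0<..} u * (u powr (- (q / 2) - 1) * exp (- ((norm \<xi>)\<^sup>2 / u)))"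
      unfolding norm_of_real by (intro abs_of_nonneg mult_nonneg_nonneg) auto
    then show "norm (joint v u \<xi>) = norm (h (\<xi> \<bullet> v)) *
        (indicator {0<..} u * (u powr (- (q / 2) - 1) * exp (- ((norm \<xi>)\<^sup>2 / u))))"
      by (simp only: joint_def norm_mult q_def)
  qed
  also have "\<dots> = ennreal (norm (h (\<xi> \<bullet> v)) * (Gamma (q / 2) * inverse (norm \<xi> powr q)))"
    using has_bochner_integral_mult_right[OF **, of "norm (h (\<xi> \<bullet> v))"]
    by (subst nn_integral_eq_integral) (auto simp: has_bochner_integral_iff)
  also have "norm (h (\<xi> \<bullet> v)) * (Gamma (q / 2) * inverse (norm \<xi> powr q)) =
      Gamma (q / 2) * norm (h (\<xi> \<bullet> v) / complex_of_real (norm \<xi> powr q))"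
  proof -
    have "norm (complex_of_real (norm \<xi> powr q)) = norm \<xi> powr q" by simp
    then have "norm (h (\<xi> \<bullet> v) / complex_of_real (norm \<xi> powr q)) = norm (h (\<xi> \<bullet> v)) / norm \<xi> powr q"
      by (simp only: norm_divide)
    then show ?thesis by (simp only:) (simp only: divide_inverse mult_ac)
  qed
  finally show "(\<integral>\<^sup>+ u. norm (joint v u \<xi>) \<partial>lborel) = ennreal (Gamma (q / 2) * norm (h (\<xi> \<bullet> v) / complex_of_real (norm \<xi> powr q)))" .
qed

lemma nn_integral_kernel_bound:
  fixes v :: "'a::euclidean_space"
  defines "q \<equiv> real DIM('a) + \<alpha>"
  shows "(\<integral>\<^sup>+ \<xi>. norm (h (\<xi> \<bullet> v) / complex_of_real (norm \<xi> powr q)) \<partial>lborel) \<le>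
           ennreal (bound_const DIM('a) / Gamma (q / 2) * norm v powr \<alpha>)"
proof -
  have G: "Gamma (q / 2) > 0" using exponent by (intro Gamma_real_pos) (simp add: q_def add_nonneg_pos)
  have "ennreal (Gamma (q / 2)) * (\<integral>\<^sup>+ \<xi>. norm (h (\<xi> \<bullet> v) / complex_of_real (norm \<xi> powr q)) \<partial>lborel) =
      (\<integral>\<^sup>+ \<xi>. ennreal (Gamma (q / 2) * norm (h (\<xi> \<bullet> v) / complex_of_real (norm \<xi> powr q))) \<partial>lborel)"
    using G by (subst nn_integral_cmult[symmetric]) (auto simp: ennreal_mult)
  also have "\<dots> = (\<integral>\<^sup>+ \<xi>. (\<integral>\<^sup>+ u. norm (joint v u \<xi>) \<partial>lborel) \<partial>lborel)"
    by (rule nn_integral_cong_AE, rule eventually_mono[OF AE_lborel_singleton[of 0]])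
       (simp add: Gamma_subordination(2) q_def)
  also have "\<dots> = (\<integral>\<^sup>+ u. (\<integral>\<^sup>+ \<xi>. norm (joint v u \<xi>) \<partial>lborel) \<partial>lborel)"
  proof (rule lborel_pair.Fubini')
    have "(\<lambda>x. ennreal (norm (case x of (u, \<xi>) \<Rightarrow> joint v u \<xi>))) \<in> borel_measurable (lborel \<Otimes>\<^sub>M lborel)"
      using measurable_joint[of v] by measurable
    then show "(\<lambda>(u, \<xi>). ennreal (norm (joint v u \<xi>))) \<in> borel_measurable (lborel \<Otimes>\<^sub>M lborel)"
      by (simp only: split_beta')
  qed
  also have "\<dots> \<le> ennreal (bound_const DIM('a) * norm v powr \<alpha>)" by (rule nn_integral_joint_bound)
  also have "\<dots> = ennreal (Gamma (q / 2)) * ennreal (bound_const DIM('a) / Gamma (q / 2) * norm v powr \<alpha>)"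
    using G bound_const_nonneg by (subst ennreal_mult[symmetric]) auto
  finally have *: "ennreal (Gamma (q / 2)) * (\<integral>\<^sup>+ \<xi>. norm (h (\<xi> \<bullet> v) / complex_of_real (norm \<xi> powr q)) \<partial>lborel) \<le>
      ennreal (Gamma (q / 2)) * ennreal (bound_const DIM('a) / Gamma (q / 2) * norm v powr \<alpha>)" .
  have "ennreal (Gamma (q / 2)) \<noteq> 0" using G by simp
  from iffD1[OF ennreal_mult_le_mult_iff[OF this ennreal_neq_top] *] show ?thesis .
qed

lemma integral_kernel:
  fixes v :: "'a::euclidean_space"
  defines "q \<equiv> real DIM('a) + \<alpha>"
  shows "complex_of_real (Gamma (q / 2)) * (\<integral>\<xi>. h (\<xi> \<bullet> v) / complex_of_real (norm \<xi> powr q) \<partial>lborel) =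
     (\<integral>u. (\<integral>\<xi>. joint v u \<xi> \<partial>lborel) \<partial>lborel)"
proof -
  have "complex_of_real (Gamma (q / 2)) * (\<integral>\<xi>. h (\<xi> \<bullet> v) / complex_of_real (norm \<xi> powr q) \<partial>lborel) =
     (\<integral>\<xi>. complex_of_real (Gamma (q / 2)) * (h (\<xi> \<bullet> v) / complex_of_real (norm \<xi> powr q)) \<partial>lborel)"
    by (simp only: integral_mult_right_zero)
  also have "\<dots> = (\<integral>\<xi>. (\<integral>u. joint v u \<xi> \<partial>lborel) \<partial>lborel)"
  proof (rule Bochner_Integration.integral_cong_AE)
    have "integrable lborel (\<lambda>\<xi>. \<integral>u. joint v u \<xi> \<partial>lborel)"
      using integrable_joint[of v] by (rule lborel_pair.integrable_snd)
    then show "(\<lambda>\<xi>. \<integral>u. joint v u \<xi> \<partial>lborel) \<in> borel_measurable lborel"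
      by (rule borel_measurable_integrable)
    have "complex_of_real (Gamma (q / 2)) * (h (\<xi> \<bullet> v) / complex_of_real (norm \<xi> powr q)) =
        (\<integral>u. joint v u \<xi> \<partial>lborel)" if "\<xi> \<noteq> 0" for \<xi>
      using Gamma_subordination(1)[OF that, of v] unfolding q_def has_bochner_integral_iff by (metis (no_types))
    then show "AE \<xi> in lborel. complex_of_real (Gamma (q / 2)) * (h (\<xi> \<bullet> v) / complex_of_real (norm \<xi> powr q)) =
        (\<integral>u. joint v u \<xi> \<partial>lborel)"
      by (intro eventually_mono[OF AE_lborel_singleton[of 0]])
    show "(\<lambda>\<xi>. complex_of_real (Gamma (q / 2)) * (h (\<xi> \<bullet> v) / complex_of_real (norm \<xi> powr q))) \<in> borel_measurable lborel"
      by simp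
  qed
  also have "\<dots> = (\<integral>u. (\<integral>\<xi>. joint v u \<xi> \<partial>lborel) \<partial>lborel)"
    by (rule lborel_pair.Fubini_integral) (rule integrable_joint)
  finally show ?thesis .
qed

text \<open>The integral over \<open>\<xi>\<close> is carried out by hypothesis, and the remaining integral over \<open>u\<close> is the Mellin
  transform of an exponential sum. The condition on \<open>\<alpha>\<close> keeps \<open>-\<alpha>/2\<close> away from the poles of \<open>\<Gamma>\<close>, and
  \<open>(k + 1) div 2\<close> is the number of even moments below \<open>k\<close>, all of which vanish. The Gaussian integral is
  a hypothesis because the complex exponential difference and its real part have the same one.\<close>

lemma integral_kernel_eq:
  fixes v :: "'a::euclidean_space"
  assumes gauss: "\<And>u. u > 0 \<Longrightarrow>
      (\<integral>\<xi>. h (\<xi> \<bullet> v) * complex_of_real (exp (- ((norm \<xi>)\<^sup>2 / u))) \<partial>lborel) =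
      complex_of_real ((pi * u) powr (real DIM('a) / 2) *
        (\<Sum>m\<le>k. real (k choose m) * (- 1) ^ (k - m) * exp (- (u * ((real m)\<^sup>2 * (norm v)\<^sup>2 / 4)))))"
    and "\<alpha> \<notin> \<int> \<or> (odd k \<and> \<alpha> = real k)" and "\<alpha> < real (2 * ((k + 1) div 2))"
  shows "(\<integral>\<xi>. h (\<xi> \<bullet> v) / complex_of_real (norm \<xi> powr (real DIM('a) + \<alpha>)) \<partial>lborel) =
     complex_of_real (kernel_const k \<alpha> DIM('a) * norm v powr \<alpha>)"
proof -
  define q where "q = real DIM('a) + \<alpha>"
  define c where "c m = real (k choose m) * (- 1) ^ (k - m)" for m
  define l where "l m = (real m)\<^sup>2 * (norm v)\<^sup>2 / 4" for m
  define g where "g u = (\<Sum>m\<le>k. c m * exp (- (u * l m)))" for u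
  have G: "Gamma (q / 2) > 0" using exponent by (intro Gamma_real_pos) (simp add: q_def add_nonneg_pos)
  have slice: "(\<integral>\<xi>. joint v u \<xi> \<partial>lborel) =
     complex_of_real (pi powr (real DIM('a) / 2) * (indicator {0<..} u * (u powr (- (\<alpha> / 2) - 1) * g u)))" for u
  proof (cases "u > 0")
    case u: True
    have p: "u powr (- (q / 2) - 1) * u powr (real DIM('a) / 2) = u powr (- (\<alpha> / 2) - 1)"
      unfolding q_def by (simp add: powr_add[symmetric] add_divide_distrib)
    have "(\<integral>\<xi>. joint v u \<xi> \<partial>lborel) =
       (\<integral>\<xi>. complex_of_real (u powr (- (q / 2) - 1)) * (h (\<xi> \<bullet> v) * complex_of_real (exp (- ((norm \<xi>)\<^sup>2 / u)))) \<partial>lborel)"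
      using u by (intro Bochner_Integration.integral_cong) (auto simp: joint_def q_def)
    also have "\<dots> = complex_of_real (u powr (- (q / 2) - 1)) *
       complex_of_real ((pi * u) powr (real DIM('a) / 2) * g u)"
      by (simp only: integral_mult_right_zero gauss[OF u] g_def c_def l_def)
    also have "\<dots> = complex_of_real (pi powr (real DIM('a) / 2) *
        ((u powr (- (q / 2) - 1) * u powr (real DIM('a) / 2)) * g u))"
      using u by (simp add: powr_mult mult_ac)
    also have "\<dots> = complex_of_real (pi powr (real DIM('a) / 2) * (indicator {0<..} u * (u powr (- (\<alpha> / 2) - 1) * g u)))"
      using u by (simp only: p) simp
    finally show ?thesis .
  next
    case False
    then show ?thesis by (simp add: joint_def)
  qed
  have "has_bochner_integral lborel (\<lambda>u. indicator {0<..} u * (u powr (- (\<alpha> / 2) - 1) * g u))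
     (Gamma (- (\<alpha> / 2)) * (\<Sum>m\<le>k. c m * l m powr (\<alpha> / 2)))"
    unfolding g_def
  proof (rule mellin_exponential_sum)
    show "\<alpha> / 2 < real ((k + 1) div 2)" using assms(3) by simp
    show "\<alpha> / 2 \<noteq> real n" for n
    proof
      assume "\<alpha> / 2 = real n"
      then have a: "\<alpha> = real (2 * n)" by simp
      then have "\<alpha> \<in> \<int>" by simp
      with assms(2) have "odd k" "real k = real (2 * n)" using a by auto
      then show False by (metis of_nat_eq_iff dvd_triv_left)
    qed
    show "(\<Sum>m\<le>k. c m * l m ^ j) = 0" if "j < (k + 1) div 2" for j
    proof -
      have "(\<Sum>m\<le>k. c m * l m ^ j) = (\<Sum>m\<le>k. ((norm v)\<^sup>2 / 4) ^ j * (c m * real m ^ (2 * j)))"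
        by (intro sum.cong) (auto simp: l_def power_mult power_mult_distrib power_divide)
      also have "\<dots> = ((norm v)\<^sup>2 / 4) ^ j * (\<Sum>m\<le>k. c m * real m ^ (2 * j))"
        by (rule sum_distrib_left[symmetric])
      also have "(\<Sum>m\<le>k. c m * real m ^ (2 * j)) = 0"
        unfolding c_def by (rule binomial_difference_power_eq_0) (use that in linarith)
      finally show ?thesis by simp
    qed
  qed (use exponent in \<open>auto simp: l_def\<close>)
  then have "(\<integral>u. indicator {0<..} u * (u powr (- (\<alpha> / 2) - 1) * g u) \<partial>lborel) =
      Gamma (- (\<alpha> / 2)) * (\<Sum>m\<le>k. c m * l m powr (\<alpha> / 2))"
    by (simp add: has_bochner_integral_iff)
  moreover have "(\<Sum>m\<le>k. c m * l m powr (\<alpha> / 2)) = S_const k \<alpha> * (norm v powr \<alpha> / 2 powr \<alpha>)"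
  proof -
    have l: "l m powr (\<alpha> / 2) = real m powr \<alpha> * (norm v powr \<alpha> / 2 powr \<alpha>)" for m
    proof -
      define y where "y = real m * norm v / 2"
      have "l m = y powr 2"
        unfolding y_def by (subst powr_numeral) (auto simp: l_def power_mult_distrib power_divide)
      moreover have "2 * (\<alpha> / 2) = \<alpha>" by simp
      ultimately have "l m powr (\<alpha> / 2) = (real m * norm v / 2) powr \<alpha>" by (simp only: powr_powr y_def)
      then show ?thesis by (simp add: powr_mult powr_divide)
    qed
    have "(\<Sum>m\<le>k. c m * l m powr (\<alpha> / 2)) = (\<Sum>m\<le>k. c m * real m powr \<alpha>) * (norm v powr \<alpha> / 2 powr \<alpha>)"
      by (simp only: l sum_distrib_right mult.assoc)
    also have "(\<Sum>m\<le>k. c m * real m powr \<alpha>) = S_const k \<alpha>"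
      unfolding S_const_def c_def using exponent
      by (intro sum.mono_neutral_right) (auto simp: Suc_le_eq)
    finally show ?thesis .
  qed
  ultimately have "(\<integral>u. indicator {0<..} u * (u powr (- (\<alpha> / 2) - 1) * g u) \<partial>lborel) =
      Gamma (- \<alpha> / 2) * (S_const k \<alpha> * (norm v powr \<alpha> / 2 powr \<alpha>))" by simp
  moreover have "complex_of_real (Gamma (q / 2)) * (\<integral>\<xi>. h (\<xi> \<bullet> v) / complex_of_real (norm \<xi> powr q) \<partial>lborel) =
     complex_of_real (pi powr (real DIM('a) / 2) *
       (\<integral>u. indicator {0<..} u * (u powr (- (\<alpha> / 2) - 1) * g u) \<partial>lborel))"
    unfolding q_def integral_kernel slice integral_complex_of_real by (simp only: integral_mult_right_zero)
  ultimately have e: "complex_of_real (Gamma (q / 2)) * (\<integral>\<xi>. h (\<xi> \<bullet> v) / complex_of_real (norm \<xi> powr q) \<partial>lborel) =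
     complex_of_real (pi powr (real DIM('a) / 2) * (Gamma (- \<alpha> / 2) * (S_const k \<alpha> * (norm v powr \<alpha> / 2 powr \<alpha>))))"
    by (simp only:)
  have "pi powr (real DIM('a) / 2) * (Gamma (- \<alpha> / 2) * (S_const k \<alpha> * (norm v powr \<alpha> / 2 powr \<alpha>))) =
      Gamma (q / 2) * (kernel_const k \<alpha> DIM('a) * norm v powr \<alpha>)"
    using G by (simp add: kernel_const_def q_def)
  with e have "complex_of_real (Gamma (q / 2)) * (\<integral>\<xi>. h (\<xi> \<bullet> v) / complex_of_real (norm \<xi> powr q) \<partial>lborel) =
     complex_of_real (Gamma (q / 2)) * complex_of_real (kernel_const k \<alpha> DIM('a) * norm v powr \<alpha>)"
    by (simp only: of_real_mult)
  moreover have "complex_of_real (Gamma (q / 2)) \<noteq> 0" using G by simp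
  ultimately have "(\<integral>\<xi>. h (\<xi> \<bullet> v) / complex_of_real (norm \<xi> powr q) \<partial>lborel) =
      complex_of_real (kernel_const k \<alpha> DIM('a) * norm v powr \<alpha>)"
    using mult_left_cancel by blast
  then show ?thesis unfolding q_def .
qed

text \<open>The absolute bound for a single \<open>v\<close> is proportional to \<open>\<bar>v\<bar>^\<alpha>\<close>, hence \<open>\<mu>\<close>-integrable, and Fubini reduces the
  average to the single-\<open>v\<close> identity.\<close>

lemma integral_kernel_average:
  fixes \<mu> :: "'a::euclidean_space measure"
  assumes \<mu>: "\<mu> \<in> moment_prob_measures \<alpha>"
    and B: "\<And>v::'a. (\<integral>\<xi>. h (\<xi> \<bullet> v) / complex_of_real (norm \<xi> powr (real DIM('a) + \<alpha>)) \<partial>lborel) =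
          complex_of_real (B * norm v powr \<alpha>)"
  shows "integrable lborel (\<lambda>\<xi>. (\<integral>v. h (\<xi> \<bullet> v) \<partial>\<mu>) / complex_of_real (norm \<xi> powr (real DIM('a) + \<alpha>)))"
    and "(\<integral>\<xi>. (\<integral>v. h (\<xi> \<bullet> v) \<partial>\<mu>) / complex_of_real (norm \<xi> powr (real DIM('a) + \<alpha>)) \<partial>lborel) =
           complex_of_real (B * (\<integral>v. norm v powr \<alpha> \<partial>\<mu>))"
proof -
  define q where "q = real DIM('a) + \<alpha>"
  have ps: "prob_space \<mu>" and sets [measurable_cong]: "sets \<mu> = sets borel"
    and fin: "(\<integral>\<^sup>+ v. ennreal (norm v powr \<alpha>) \<partial>\<mu>) < \<infinity>"
    using \<mu> by (auto simp: moment_prob_measures_def)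
  interpret prob_space \<mu> by fact
  interpret pair_sigma_finite "lborel :: 'a measure" \<mu> ..
  define f where "f \<xi> v = h (\<xi> \<bullet> v) / complex_of_real (norm \<xi> powr q)" for \<xi> v :: 'a
  have meas: "case_prod f \<in> borel_measurable (lborel \<Otimes>\<^sub>M \<mu>)"
    unfolding f_def by measurable
  have int: "integrable (lborel \<Otimes>\<^sub>M \<mu>) (case_prod f)"
  proof (rule integrableI_bounded)
    have "(\<lambda>x. ennreal (norm (case_prod f x))) \<in> borel_measurable (lborel \<Otimes>\<^sub>M \<mu>)" using meas by measurable
    from nn_integral_snd[OF this]
    have "(\<integral>\<^sup>+ x. norm (case_prod f x) \<partial>(lborel \<Otimes>\<^sub>M \<mu>)) = (\<integral>\<^sup>+ v. (\<integral>\<^sup>+ \<xi>. norm (f \<xi> v) \<partial>lborel) \<partial>\<mu>)"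
      by simp
    also have "\<dots> \<le> (\<integral>\<^sup>+ v. ennreal (bound_const DIM('a) / Gamma (q / 2)) * ennreal (norm v powr \<alpha>) \<partial>\<mu>)"
    proof (rule nn_integral_mono)
      fix v :: 'a
      have "Gamma (q / 2) > 0" using exponent by (intro Gamma_real_pos) (simp add: q_def add_nonneg_pos)
      then have "ennreal (bound_const DIM('a) / Gamma (q / 2)) * ennreal (norm v powr \<alpha>) = ennreal (bound_const DIM('a) / Gamma (q / 2) * norm v powr \<alpha>)"
        using bound_const_nonneg by (subst ennreal_mult) auto
      then show "(\<integral>\<^sup>+ \<xi>. norm (f \<xi> v) \<partial>lborel) \<le> ennreal (bound_const DIM('a) / Gamma (q / 2)) * ennreal (norm v powr \<alpha>)"
        using nn_integral_kernel_bound[of v] unfolding f_def q_def by (simp only:)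
    qed
    also have "\<dots> = ennreal (bound_const DIM('a) / Gamma (q / 2)) * (\<integral>\<^sup>+ v. ennreal (norm v powr \<alpha>) \<partial>\<mu>)"
      by (rule nn_integral_cmult) measurable
    also have "\<dots> < \<infinity>" using fin by (simp add: ennreal_mult_less_top)
    finally show "(\<integral>\<^sup>+ x. norm (case_prod f x) \<partial>(lborel \<Otimes>\<^sub>M \<mu>)) < \<infinity>" .
  qed (rule meas)
  have inner: "(\<integral>v. f \<xi> v \<partial>\<mu>) = (\<integral>v. h (\<xi> \<bullet> v) \<partial>\<mu>) / complex_of_real (norm \<xi> powr q)" for \<xi>
    unfolding f_def by (rule integral_divide_zero)
  show "integrable lborel (\<lambda>\<xi>. (\<integral>v. h (\<xi> \<bullet> v) \<partial>\<mu>) / complex_of_real (norm \<xi> powr (real DIM('a) + \<alpha>)))"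
    using integrable_fst[OF int] unfolding inner q_def .
  have "(\<integral>\<xi>. (\<integral>v. f \<xi> v \<partial>\<mu>) \<partial>lborel) = (\<integral>v. (\<integral>\<xi>. f \<xi> v \<partial>lborel) \<partial>\<mu>)"
    by (rule Fubini_integral[OF int, symmetric])
  also have "\<dots> = (\<integral>v. complex_of_real (B * norm v powr \<alpha>) \<partial>\<mu>)"
    unfolding f_def q_def by (simp only: B)
  also have "\<dots> = complex_of_real (B * (\<integral>v. norm v powr \<alpha> \<partial>\<mu>))"
    unfolding integral_complex_of_real by (simp only: integral_mult_right_zero)
  finally show "(\<integral>\<xi>. (\<integral>v. h (\<xi> \<bullet> v) \<partial>\<mu>) / complex_of_real (norm \<xi> powr (real DIM('a) + \<alpha>)) \<partial>lborel) =
           complex_of_real (B * (\<integral>v. norm v powr \<alpha> \<partial>\<mu>))"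
    unfolding inner q_def .
qed

end

section \<open>The difference of the exponential function\<close>

definition diff_exp :: "nat \<Rightarrow> real \<Rightarrow> complex" where
  "diff_exp k s = (exp (- (\<i> * complex_of_real s)) - 1) ^ k"

lemma diff_exp_expand:
  "diff_exp k s = (\<Sum>m\<le>k. complex_of_real (real (k choose m) * (- 1) ^ (k - m)) * exp (- (\<i> * complex_of_real (real m * s))))"
proof -
  have e: "exp (- (\<i> * complex_of_real (real m * s))) = exp (- (\<i> * complex_of_real s)) ^ m" for m
    by (simp add: exp_of_nat_mult[symmetric] mult_ac)
  have "diff_exp k s = (exp (- (\<i> * complex_of_real s)) + - 1) ^ k" by (simp add: diff_exp_def)
  also have "\<dots> = (\<Sum>m\<le>k. of_nat (k choose m) * exp (- (\<i> * complex_of_real s)) ^ m * (- 1) ^ (k - m))"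
    by (rule binomial_ring)
  also have "\<dots> = (\<Sum>m\<le>k. complex_of_real (real (k choose m) * (- 1) ^ (k - m)) * exp (- (\<i> * complex_of_real (real m * s))))"
    unfolding e by (intro sum.cong refl) (simp add: mult_ac)
  finally show ?thesis .
qed

lemma measurable_diff_exp [measurable]: "diff_exp k \<in> borel_measurable borel"
  unfolding diff_exp_def by (intro borel_measurable_continuous_onI continuous_intros)

lemma norm_exp_ii_minus_1: "norm (exp (- (\<i> * complex_of_real s)) - 1) \<le> \<bar>s\<bar>"
  using iexp_approx1[of "- s" 0] by simp

lemma norm_diff_exp_le: "norm (diff_exp k s) \<le> 2 ^ k"
proof -
  have "norm (exp (- (\<i> * complex_of_real s)) - 1) \<le> norm (exp (- (\<i> * complex_of_real s))) + norm (1::complex)"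
    by (rule norm_triangle_ineq4)
  also have "\<dots> = 2" by (simp add: norm_exp_eq_Re)
  finally show ?thesis unfolding diff_exp_def norm_power by (intro power_mono) auto
qed

lemma norm_diff_exp_small: "norm (diff_exp k s) \<le> \<bar>s\<bar> ^ k"
  unfolding diff_exp_def norm_power by (intro power_mono norm_exp_ii_minus_1) auto

text \<open>For odd \<open>k\<close>, conjugating \<open>w = (z - 1)^k\<close> with \<open>\<bar>z\<bar> = 1\<close> gives \<open>- cnj z^k w\<close>. Hence \<open>2 Re w = w (1 - cnj z^k)\<close>, and
  the second factor contributes one more power of \<open>s\<close>.\<close>

lemma Re_diff_exp_small:
  assumes "odd k"
  shows "\<bar>Re (diff_exp k s)\<bar> \<le> real k * \<bar>s\<bar> ^ (k + 1)"
proof -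
  define z where "z = exp (- (\<i> * complex_of_real s))"
  have z: "cnj z * z = 1" by (simp add: z_def exp_cnj exp_add[symmetric])
  have "cnj (z - 1) = - (cnj z) * (z - 1)" using z by (simp add: algebra_simps)
  then have "cnj (diff_exp k s) = (- (cnj z) * (z - 1)) ^ k" by (simp only: diff_exp_def z_def complex_cnj_power)
  also have "\<dots> = - (cnj z ^ k * diff_exp k s)"
    using assms by (simp only: power_mult_distrib power_minus_odd diff_exp_def z_def) simp
  finally have c: "cnj (diff_exp k s) = - (cnj z ^ k * diff_exp k s)" .
  have "complex_of_real (2 * Re (diff_exp k s)) = diff_exp k s + cnj (diff_exp k s)"
    by (simp add: complex_add_cnj)
  also have "\<dots> = diff_exp k s * - (cnj z ^ k - 1)" unfolding c by (simp add: algebra_simps)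
  also have "cnj z ^ k = exp (- (\<i> * complex_of_real (- (real k * s))))"
    by (simp add: z_def exp_cnj exp_of_nat_mult[symmetric] mult_ac)
  finally have "\<bar>2 * Re (diff_exp k s)\<bar> = norm (diff_exp k s) * norm (exp (- (\<i> * complex_of_real (- (real k * s)))) - 1)"
    by (metis norm_minus_cancel norm_mult norm_of_real)
  also have "\<dots> \<le> \<bar>s\<bar> ^ k * \<bar>- (real k * s)\<bar>"
    by (intro mult_mono norm_diff_exp_small norm_exp_ii_minus_1) auto
  finally have "2 * \<bar>Re (diff_exp k s)\<bar> \<le> real k * \<bar>s\<bar> ^ (k + 1)" by (simp add: abs_mult mult_ac)
  then show ?thesis by linarith
qed

lemma gaussian_diff_exp:
  fixes v :: "'a::euclidean_space"
  assumes u: "u > 0"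
  shows "integrable lborel (\<lambda>\<xi>. diff_exp k (\<xi> \<bullet> v) * complex_of_real (exp (- ((norm \<xi>)\<^sup>2 / u))))"
    and "(\<integral>\<xi>. diff_exp k (\<xi> \<bullet> v) * complex_of_real (exp (- ((norm \<xi>)\<^sup>2 / u))) \<partial>lborel) =
      complex_of_real ((pi * u) powr (real DIM('a) / 2) *
        (\<Sum>m\<le>k. real (k choose m) * (- 1) ^ (k - m) * exp (- (u * ((real m)\<^sup>2 * (norm v)\<^sup>2 / 4)))))"
proof -
  define c where "c m = real (k choose m) * (- 1) ^ (k - m)" for m
  have e: "diff_exp k (\<xi> \<bullet> v) * complex_of_real (exp (- ((norm \<xi>)\<^sup>2 / u))) =
     (\<Sum>m\<le>k. complex_of_real (c m) * (exp (- (\<i> * complex_of_real (\<xi> \<bullet> (real m *\<^sub>R v)))) * exp (- complex_of_real ((norm \<xi>)\<^sup>2 / u))))" for \<xi>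
    unfolding diff_exp_expand sum_distrib_right c_def
    by (intro sum.cong refl) (simp add: exp_of_real[symmetric] mult_ac)
  show "integrable lborel (\<lambda>\<xi>. diff_exp k (\<xi> \<bullet> v) * complex_of_real (exp (- ((norm \<xi>)\<^sup>2 / u))))"
    unfolding e by (intro Bochner_Integration.integrable_sum integrable_mult_right gaussian_fourier(1) u)
  have "(\<integral>\<xi>. diff_exp k (\<xi> \<bullet> v) * complex_of_real (exp (- ((norm \<xi>)\<^sup>2 / u))) \<partial>lborel) =
     (\<Sum>m\<le>k. complex_of_real (c m) * complex_of_real ((pi * u) powr (real DIM('a) / 2) * exp (- (u * (norm (real m *\<^sub>R v))\<^sup>2 / 4))))"
    unfolding e
    by (subst Bochner_Integration.integral_sum)
       (intro integrable_mult_right gaussian_fourier(1) u, simp only: integral_mult_right_zero gaussian_fourier(2)[OF u])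
  also have "\<dots> = complex_of_real ((pi * u) powr (real DIM('a) / 2) *
        (\<Sum>m\<le>k. c m * exp (- (u * ((real m)\<^sup>2 * (norm v)\<^sup>2 / 4)))))"
    unfolding of_real_mult[symmetric] of_real_sum[symmetric] sum_distrib_left
    by (intro arg_cong[where f=complex_of_real] sum.cong refl) (simp add: power_mult_distrib)
  finally show "(\<integral>\<xi>. diff_exp k (\<xi> \<bullet> v) * complex_of_real (exp (- ((norm \<xi>)\<^sup>2 / u))) \<partial>lborel) =
      complex_of_real ((pi * u) powr (real DIM('a) / 2) *
        (\<Sum>m\<le>k. real (k choose m) * (- 1) ^ (k - m) * exp (- (u * ((real m)\<^sup>2 * (norm v)\<^sup>2 / 4)))))"
    unfolding c_def .
qed

corollary gaussian_Re_diff_exp: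
  fixes v :: "'a::euclidean_space"
  assumes u: "u > 0"
  shows "(\<integral>\<xi>. complex_of_real (Re (diff_exp k (\<xi> \<bullet> v))) * complex_of_real (exp (- ((norm \<xi>)\<^sup>2 / u))) \<partial>lborel) =
      complex_of_real ((pi * u) powr (real DIM('a) / 2) *
        (\<Sum>m\<le>k. real (k choose m) * (- 1) ^ (k - m) * exp (- (u * ((real m)\<^sup>2 * (norm v)\<^sup>2 / 4)))))"
proof -
  have "(\<integral>\<xi>. complex_of_real (Re (diff_exp k (\<xi> \<bullet> v))) * complex_of_real (exp (- ((norm \<xi>)\<^sup>2 / u))) \<partial>lborel) =
     complex_of_real (\<integral>\<xi>. Re (diff_exp k (\<xi> \<bullet> v) * complex_of_real (exp (- ((norm \<xi>)\<^sup>2 / u)))) \<partial>lborel)"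
    unfolding integral_complex_of_real[symmetric]
    by (intro Bochner_Integration.integral_cong refl) simp
  also have "(\<integral>\<xi>. Re (diff_exp k (\<xi> \<bullet> v) * complex_of_real (exp (- ((norm \<xi>)\<^sup>2 / u)))) \<partial>lborel) =
     Re (\<integral>\<xi>. diff_exp k (\<xi> \<bullet> v) * complex_of_real (exp (- ((norm \<xi>)\<^sup>2 / u))) \<partial>lborel)"
    by (rule integral_Re[OF gaussian_diff_exp(1)[OF u]])
  finally show ?thesis by (simp only: gaussian_diff_exp(2)[OF u] Re_complex_of_real)
qed

lemma forward_diff0_fourier_transform:
  fixes \<mu> :: "'a::euclidean_space measure"
  assumes "prob_space \<mu>" and sets [measurable_cong]: "sets \<mu> = sets borel"
  shows "forward_diff0 k (fourier_transform \<mu>) \<xi> = (\<integral>v. diff_exp k (\<xi> \<bullet> v) \<partial>\<mu>)"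
    and "integrable \<mu> (\<lambda>v. diff_exp k (\<xi> \<bullet> v))"
proof -
  interpret prob_space \<mu> by fact
  have i: "integrable \<mu> (\<lambda>v. exp (- (\<i> * complex_of_real (real m * (\<xi> \<bullet> v)))))" for m
    by (rule integrable_const_bound[of _ 1]) (auto simp: norm_exp_eq_Re)
  show "integrable \<mu> (\<lambda>v. diff_exp k (\<xi> \<bullet> v))"
    unfolding diff_exp_expand by (intro Bochner_Integration.integrable_sum integrable_mult_right i)
  have "(\<integral>v. diff_exp k (\<xi> \<bullet> v) \<partial>\<mu>) =
    (\<Sum>m\<le>k. complex_of_real (real (k choose m) * (- 1) ^ (k - m)) * (\<integral>v. exp (- (\<i> * complex_of_real (real m * (\<xi> \<bullet> v)))) \<partial>\<mu>))"
    unfolding diff_exp_expand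
    by (subst Bochner_Integration.integral_sum) (intro integrable_mult_right i, simp only: integral_mult_right_zero)
  also have "\<dots> = forward_diff0 k (fourier_transform \<mu>) \<xi>"
    unfolding forward_diff0_def fourier_transform_def
    by (simp add: atLeast0AtMost)
  finally show "forward_diff0 k (fourier_transform \<mu>) \<xi> = (\<integral>v. diff_exp k (\<xi> \<bullet> v) \<partial>\<mu>)" ..
qed

lemma forward_diff0_Re:
  "forward_diff0 k (\<lambda>x. Re (\<phi> x)) \<xi> = Re (forward_diff0 k \<phi> \<xi>)"
proof -
  have "Re (of_nat n * (- 1) ^ j * z) = of_nat n * (- 1) ^ j * Re z" for n j and z :: complex
    by (cases "even j") simp_all
  then show ?thesis by (simp only: forward_diff0_def Re_sum)
qed

section \<open>The moment formulas\<close>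

lemma moment_formula_complex:
  fixes \<mu> :: "'a::euclidean_space measure"
  assumes \<mu>: "\<mu> \<in> moment_prob_measures \<alpha>" and \<alpha>: "0 < \<alpha>" "\<alpha> < real k" "\<alpha> \<notin> \<int>"
  shows "integrable lborel (\<lambda>\<xi>. forward_diff0 k (fourier_transform \<mu>) \<xi> / complex_of_real (norm \<xi> powr (real DIM('a) + \<alpha>)))"
    and "(\<integral>\<xi>. forward_diff0 k (fourier_transform \<mu>) \<xi> / complex_of_real (norm \<xi> powr (real DIM('a) + \<alpha>)) \<partial>lborel) =
          complex_of_real (kernel_const k \<alpha> DIM('a) * (\<integral>v. norm v powr \<alpha> \<partial>\<mu>))"
proof -
  interpret D: ridge_kernel "diff_exp k" "2 ^ k" k \<alpha>
  proof
    show "norm (diff_exp k s) \<le> 2 ^ k * \<bar>s\<bar> ^ k" for s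
    proof -
      have "1 * \<bar>s\<bar> ^ k \<le> 2 ^ k * \<bar>s\<bar> ^ k" by (intro mult_right_mono) auto
      with norm_diff_exp_small[of k s] show ?thesis by simp
    qed
  qed (use \<alpha> norm_diff_exp_le in auto)
  have "k \<le> 2 * ((k + 1) div 2)" by linarith
  then have J: "\<alpha> < real (2 * ((k + 1) div 2))" using \<alpha>(2) by linarith
  have p: "prob_space \<mu>" "sets \<mu> = sets borel" using \<mu> by (auto simp: moment_prob_measures_def)
  note K = D.integral_kernel_eq[OF gaussian_diff_exp(2) disjI1[OF \<alpha>(3)] J]
  show "integrable lborel (\<lambda>\<xi>. forward_diff0 k (fourier_transform \<mu>) \<xi> / complex_of_real (norm \<xi> powr (real DIM('a) + \<alpha>)))"
    and "(\<integral>\<xi>. forward_diff0 k (fourier_transform \<mu>) \<xi> / complex_of_real (norm \<xi> powr (real DIM('a) + \<alpha>)) \<partial>lborel) =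
          complex_of_real (kernel_const k \<alpha> DIM('a) * (\<integral>v. norm v powr \<alpha> \<partial>\<mu>))"
    unfolding forward_diff0_fourier_transform(1)[OF p]
    by (rule D.integral_kernel_average[OF \<mu> K]; assumption)+
qed

lemma moment_formula_real:
  fixes \<mu> :: "'a::euclidean_space measure"
  assumes \<mu>: "\<mu> \<in> moment_prob_measures \<alpha>" and \<alpha>: "0 < \<alpha>" "\<alpha> < real (k + 1)" "\<alpha> \<notin> \<int> \<or> \<alpha> = real k"
    and k: "odd k"
  shows "integrable lborel (\<lambda>\<xi>. forward_diff0 k (\<lambda>x. Re (fourier_transform \<mu> x)) \<xi> / norm \<xi> powr (real DIM('a) + \<alpha>))"
    and "(\<integral>\<xi>. forward_diff0 k (\<lambda>x. Re (fourier_transform \<mu> x)) \<xi> / norm \<xi> powr (real DIM('a) + \<alpha>) \<partial>lborel) =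
          kernel_const k \<alpha> DIM('a) * (\<integral>v. norm v powr \<alpha> \<partial>\<mu>)"
proof -
  define h where "h s = complex_of_real (Re (diff_exp k s))" for s
  interpret D: ridge_kernel h "2 ^ k" "k + 1" \<alpha>
  proof
    show "h \<in> borel_measurable borel" unfolding h_def by measurable
    show "norm (h s) \<le> 2 ^ k" for s
      using norm_diff_exp_le[of k s] abs_Re_le_cmod[of "diff_exp k s"] by (simp add: h_def)
    show "norm (h s) \<le> 2 ^ k * \<bar>s\<bar> ^ (k + 1)" for s
    proof -
      have "real k \<le> 2 ^ k" using of_nat_less_two_power[of k, where ?'a=real] by simp
      then have "real k * \<bar>s\<bar> ^ (k + 1) \<le> 2 ^ k * \<bar>s\<bar> ^ (k + 1)" by (intro mult_right_mono) auto
      with Re_diff_exp_small[OF k, of s] show ?thesis unfolding h_def norm_of_real by linarith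
    qed
  qed (use \<alpha> in auto)
  have J: "\<alpha> < real (2 * ((k + 1) div 2))" using \<alpha>(2) k by simp
  have p: "prob_space \<mu>" "sets \<mu> = sets borel" using \<mu> by (auto simp: moment_prob_measures_def)
  have d: "\<alpha> \<notin> \<int> \<or> odd k \<and> \<alpha> = real k" using \<alpha> k by auto
  note K = D.integral_kernel_eq[OF gaussian_Re_diff_exp[where k=k, folded h_def] d J]
  have h: "(\<integral>v. h (\<xi> \<bullet> v) \<partial>\<mu>) / complex_of_real (norm \<xi> powr (real DIM('a) + \<alpha>)) =
     complex_of_real (forward_diff0 k (\<lambda>x. Re (fourier_transform \<mu> x)) \<xi> / norm \<xi> powr (real DIM('a) + \<alpha>))" for \<xi>
  proof -
    have "(\<integral>v. h (\<xi> \<bullet> v) \<partial>\<mu>) = complex_of_real (\<integral>v. Re (diff_exp k (\<xi> \<bullet> v)) \<partial>\<mu>)"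
      unfolding h_def by (rule integral_complex_of_real)
    also have "(\<integral>v. Re (diff_exp k (\<xi> \<bullet> v)) \<partial>\<mu>) = Re (\<integral>v. diff_exp k (\<xi> \<bullet> v) \<partial>\<mu>)"
      by (rule integral_Re[OF forward_diff0_fourier_transform(2)[OF p]])
    also have "\<dots> = forward_diff0 k (\<lambda>x. Re (fourier_transform \<mu> x)) \<xi>"
      by (simp only: forward_diff0_Re forward_diff0_fourier_transform(1)[OF p])
    finally show ?thesis by (simp only: of_real_divide)
  qed
  have "integrable lborel (\<lambda>\<xi>. complex_of_real (forward_diff0 k (\<lambda>x. Re (fourier_transform \<mu> x)) \<xi> / norm \<xi> powr (real DIM('a) + \<alpha>)))"
    unfolding h[symmetric] by (rule D.integral_kernel_average(1)[OF \<mu> K])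
  then show "integrable lborel (\<lambda>\<xi>. forward_diff0 k (\<lambda>x. Re (fourier_transform \<mu> x)) \<xi> / norm \<xi> powr (real DIM('a) + \<alpha>))"
    by (simp only: complex_of_real_integrable_eq)
  have "(\<integral>\<xi>. complex_of_real (forward_diff0 k (\<lambda>x. Re (fourier_transform \<mu> x)) \<xi> / norm \<xi> powr (real DIM('a) + \<alpha>)) \<partial>lborel) =
      complex_of_real (kernel_const k \<alpha> DIM('a) * (\<integral>v. norm v powr \<alpha> \<partial>\<mu>))"
    unfolding h[symmetric] by (rule D.integral_kernel_average(2)[OF \<mu> K])
  then show "(\<integral>\<xi>. forward_diff0 k (\<lambda>x. Re (fourier_transform \<mu> x)) \<xi> / norm \<xi> powr (real DIM('a) + \<alpha>) \<partial>lborel) =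
          kernel_const k \<alpha> DIM('a) * (\<integral>v. norm v powr \<alpha> \<partial>\<mu>)"
    by (simp only: integral_complex_of_real of_real_eq_iff)
qed

theorem theorem1:
  fixes \<mu> :: "(real ^ 'n) measure" and \<alpha> :: real and k :: nat
  assumes "\<alpha> > 0" and "k > 0" and "\<mu> \<in> moment_prob_measures \<alpha>"
  defines "d \<equiv> CARD('n)"
  defines "\<phi> \<equiv> fourier_transform \<mu>"
  shows
    "(\<alpha> \<notin> \<int> \<and> \<alpha> < real k \<longrightarrow>
        integrable lborel
          (\<lambda>\<xi>. forward_diff0 k \<phi> \<xi> / complex_of_real (norm \<xi> powr (real d + \<alpha>))) \<and>
        complex_of_real (\<integral>v. norm v powr \<alpha> \<partial>\<mu>) =
          complex_of_real (A_const k \<alpha> d) *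
            (\<integral>\<xi>. forward_diff0 k \<phi> \<xi> / complex_of_real (norm \<xi> powr (real d + \<alpha>)) \<partial>lborel)) \<and>
     (odd k \<and> (\<alpha> \<notin> \<int> \<and> \<alpha> < real (k + 1) \<or> \<alpha> = real k) \<longrightarrow>
        integrable lborel
          (\<lambda>\<xi>. forward_diff0 k (\<lambda>x. Re (\<phi> x)) \<xi> / norm \<xi> powr (real d + \<alpha>)) \<and>
        (\<integral>v. norm v powr \<alpha> \<partial>\<mu>) =
          A_const k \<alpha> d *
            (\<integral>\<xi>. forward_diff0 k (\<lambda>x. Re (\<phi> x)) \<xi> / norm \<xi> powr (real d + \<alpha>) \<partial>lborel)) \<and>
     (odd k \<and> \<alpha> \<notin> \<int> \<and> \<alpha> < real k \<longrightarrow>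
        (\<integral>\<xi>. forward_diff0 k \<phi> \<xi> / complex_of_real (norm \<xi> powr (real d + \<alpha>)) \<partial>lborel) =
        complex_of_real
          (\<integral>\<xi>. forward_diff0 k (\<lambda>x. Re (\<phi> x)) \<xi> / norm \<xi> powr (real d + \<alpha>) \<partial>lborel))"
proof (intro conjI impI; (elim conjE)?)
  have d: "DIM(real ^ 'n) = d" by (simp add: d_def)
  note C = moment_formula_complex[OF assms(3,1), of k, folded \<phi>_def, unfolded d]
  note R = moment_formula_real[OF assms(3,1), of k, folded \<phi>_def, unfolded d]
  have AB: "A_const k \<alpha> d * (kernel_const k \<alpha> d * x) = x" if "\<alpha> \<notin> \<int> \<or> odd k \<and> \<alpha> = real k" for x
  proof -
    have "S_const k \<alpha> \<noteq> 0" using that by (intro S_const_nonzero assms(1,2)) auto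
    then have "A_const k \<alpha> d * kernel_const k \<alpha> d = 1"
      by (intro A_const_kernel_const assms(1) sin_half_pi_nonzero[of \<alpha> k] that)
    then show ?thesis by (simp flip: mult.assoc)
  qed
  {
    assume "\<alpha> \<notin> \<int>" "\<alpha> < real k"
    note C' = C[OF this(2,1)]
    show "integrable lborel (\<lambda>\<xi>. forward_diff0 k \<phi> \<xi> / complex_of_real (norm \<xi> powr (real d + \<alpha>)))"
      by (rule C')
    show "complex_of_real (\<integral>v. norm v powr \<alpha> \<partial>\<mu>) = complex_of_real (A_const k \<alpha> d) *
            (\<integral>\<xi>. forward_diff0 k \<phi> \<xi> / complex_of_real (norm \<xi> powr (real d + \<alpha>)) \<partial>lborel)"
      unfolding C'(2) of_real_mult[symmetric] AB[OF disjI1[OF \<open>\<alpha> \<notin> \<int>\<close>]] ..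
  next
    assume "odd k" "\<alpha> \<notin> \<int> \<and> \<alpha> < real (k + 1) \<or> \<alpha> = real k"
    then have a: "\<alpha> < real (k + 1)" "\<alpha> \<notin> \<int> \<or> \<alpha> = real k" "\<alpha> \<notin> \<int> \<or> odd k \<and> \<alpha> = real k" by auto
    note R' = R[OF a(1,2) \<open>odd k\<close>]
    show "integrable lborel (\<lambda>\<xi>. forward_diff0 k (\<lambda>x. Re (\<phi> x)) \<xi> / norm \<xi> powr (real d + \<alpha>))"
      by (rule R')
    show "(\<integral>v. norm v powr \<alpha> \<partial>\<mu>) = A_const k \<alpha> d *
            (\<integral>\<xi>. forward_diff0 k (\<lambda>x. Re (\<phi> x)) \<xi> / norm \<xi> powr (real d + \<alpha>) \<partial>lborel)"
      unfolding R'(2) AB[OF a(3)] ..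
  next
    assume "odd k" "\<alpha> \<notin> \<int>" "\<alpha> < real k"
    then have "\<alpha> < real (k + 1)" by simp
    show "(\<integral>\<xi>. forward_diff0 k \<phi> \<xi> / complex_of_real (norm \<xi> powr (real d + \<alpha>)) \<partial>lborel) =
        complex_of_real (\<integral>\<xi>. forward_diff0 k (\<lambda>x. Re (\<phi> x)) \<xi> / norm \<xi> powr (real d + \<alpha>) \<partial>lborel)"
      unfolding C(2)[OF \<open>\<alpha> < real k\<close> \<open>\<alpha> \<notin> \<int>\<close>]
        R(2)[OF \<open>\<alpha> < real (k + 1)\<close> disjI1[OF \<open>\<alpha> \<notin> \<int>\<close>] \<open>odd k\<close>] ..
  }
qed

end
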